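(* Let $0<p_i,\sigma_i<\infty$, $-1<\alpha_i<\infty$ for $i=1,\ldots,m$. Let $\mu$ be a positive Borel measure on $\mathbb H$. Then the following two conditions are equivalent. (1) There is a constant $C>0$ such that for any $m$-tuple $(f_1,\ldots,f_m)$ of harmonic functions on $\mathbb H$, $$\int_{\mathbb H}\prod_{i=1}^m|f_i(z)|^{p_i}\,d\mu(z)\le C\prod_{i=1}^m\int_{\mathbb H}\left(\int_{Q_w}|f_i(z)|^{\sigma_i}\,dm_{\alpha_i}(z)\right)^{p_i/\sigma_i}dw.$$ (2) There is a constant $C>0$ such that $$\mu(\Delta_k)\le C\,\eta_k^{m(n+1)+\sum_{i=1}^m\frac{p_i(n+1+\alpha_i)}{\sigma_i}},\qquad k\ge1.$$
   Context: $\mathbb H=\{(x,t):x\in\mathbb R^n,\ t>0\}\subset\mathbb R^{n+1}$; points are written $z=(x,t)$ or $w=(y,s)$; $dw=dy\,ds$ is Lebesgue measure and $dm_\lambda(z)=t^\lambda\,dx\,dt$ for $\lambda\in\mathbb R$. $A\asymp B$ means $cA\le B\le CA$ for some constants $c,C>0$. For $w=(y,s)\in\mathbb H$, $Q_w$ is the cube with sides parallel to the coordinate axes, centered at $w$, with side length $s$. $\{\Delta_k\}_{k\ge1}$ is a fixed Whitney decomposition of $\mathbb H$: closed cubes in $\mathbb H$ with sides parallel to the coordinate axes, with pairwise disjoint interiors, $\bigcup_k\Delta_k=\mathbb H$, and $\operatorname{diam}\Delta_k\asymp\operatorname{dist}(\Delta_k,\partial\mathbb H)$ uniformly in $k$.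 $\zeta_k=(\xi_k,\eta_k)$ is the center of $\Delta_k$. $\Delta_k^\ast$ is the cube with the same center as $\Delta_k$ enlarged $5/4$ times; these satisfy $\Delta_k^\ast\subset\mathbb H$, $\sum_k\chi_{\Delta_k^\ast}\le C_n$, and $t\asymp\eta_k$ for $(x,t)\in\Delta_k^\ast$, uniformly in $k$. *)

theory Defs
  imports "HOL-Analysis.Analysis"
begin

text \<open>
  The space of points \<open>z = (x, t)\<close> is \<open>(real ^ 'n) \<times> real\<close>, so that \<open>n = CARD('n) \<ge> 1\<close>.
\<close>

definition upper_half_space :: "((real ^ 'n) \<times> real) set" where
  "upper_half_space = {z. snd z > 0}"

definition weighted_measure :: "real \<Rightarrow> ((real ^ 'n) \<times> real) measure" where
  "weighted_measure a =
     density (restrict_space lborel upper_half_space) (\<lambda>z. ennreal (snd z powr a))"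

text \<open>
  The closed cube with center \<open>w\<close> and side length \<open>r\<close>; the half-space cube \<open>Q\<^sub>w\<close> at
  \<open>w = (y, s)\<close> is \<open>cube w s\<close>.
\<close>

definition cube :: "'a::euclidean_space \<Rightarrow> real \<Rightarrow> 'a set" where
  "cube w r = cbox (w - (r / 2) *\<^sub>R One) (w + (r / 2) *\<^sub>R One)"

abbreviation Q_cube :: "(real ^ 'n) \<times> real \<Rightarrow> ((real ^ 'n) \<times> real) set" where
  "Q_cube w \<equiv> cube w (snd w)"

text \<open>
  The \<open>k\<close>-th cube of the decomposition is given by its center \<open>\<zeta> k\<close> and its side length \<open>l k\<close>.
\<close>

definition whitney_decomposition ::
    "'a::euclidean_space set \<Rightarrow> (nat \<Rightarrow> 'a) \<Rightarrow> (nat \<Rightarrow> real) \<Rightarrow> bool" where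
  "whitney_decomposition \<Omega> \<zeta> l \<longleftrightarrow>
     (\<forall>k. l k > 0) \<and>
     (\<forall>j k. j \<noteq> k \<longrightarrow>
        interior (cube (\<zeta> j) (l j)) \<inter> interior (cube (\<zeta> k) (l k)) = {}) \<and>
     (\<Union>k. cube (\<zeta> k) (l k)) = \<Omega> \<and>
     (\<exists>c>0. \<exists>C>0. \<forall>k.
        c * setdist (cube (\<zeta> k) (l k)) (frontier \<Omega>) \<le> diameter (cube (\<zeta> k) (l k)) \<and>
        diameter (cube (\<zeta> k) (l k)) \<le> C * setdist (cube (\<zeta> k) (l k)) (frontier \<Omega>))"

definition partial_deriv :: "'a::euclidean_space \<Rightarrow> ('a \<Rightarrow> real) \<Rightarrow> 'a \<Rightarrow> real" where
  "partial_deriv b f z = frechet_derivative f (at z) b"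

text \<open>Meaningful for open sets \<open>S\<close> only, because \<^const>\<open>partial_deriv\<close> is taken at \<open>at z\<close>.\<close>

fun Ck_on :: "nat \<Rightarrow> ('a::euclidean_space \<Rightarrow> real) \<Rightarrow> 'a set \<Rightarrow> bool" where
  "Ck_on 0 f S \<longleftrightarrow> continuous_on S f"
| "Ck_on (Suc k) f S \<longleftrightarrow>
     f differentiable_on S \<and> (\<forall>b\<in>Basis. Ck_on k (partial_deriv b f) S)"

definition laplacian :: "('a::euclidean_space \<Rightarrow> real) \<Rightarrow> 'a \<Rightarrow> real" where
  "laplacian f z = (\<Sum>b\<in>Basis. partial_deriv b (partial_deriv b f) z)"

definition harmonic_on :: "('a::euclidean_space \<Rightarrow> real) \<Rightarrow> 'a set \<Rightarrow> bool" where
  "harmonic_on f S \<longleftrightarrow> open S \<and> Ck_on 2 f S \<and> (\<forall>z\<in>S. laplacian f z = 0)"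

text \<open>Real powers on \<open>[0, \<infinity>]\<close>, intended for exponents \<open>a > 0\<close>: \<open>0\<^sup>a = 0\<close> and \<open>\<infinity>\<^sup>a = \<infinity>\<close>.\<close>

definition ennreal_powr :: "ennreal \<Rightarrow> real \<Rightarrow> ennreal" where
  "ennreal_powr x a = (if x = \<infinity> then \<infinity> else ennreal (enn2real x powr a))"

end

theory Submission
  imports Defs
begin

text \<open>
  Write \<open>d = n + 1\<close>.  For harmonic \<open>f\<close> and every exponent \<open>q > 0\<close>, \<open>\<bar>f\<bar>\<^sup>q\<close> at the center of a ball is
  bounded by a constant times its mean over the ball: \<open>q = 1\<close> is the mean value property, \<open>q > 1\<close>
  follows by truncation, and \<open>q < 1\<close> by an argument of Hardy and Littlewood.  Hence, for \<open>z = (x, t)\<close>, the number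
  \<open>\<bar>f z\<bar>\<^sup>p t\<^sup>e\<close> with \<open>e = d + p (d + \<alpha>) / \<sigma>\<close> is at most a constant times the integral of
  \<open>(\<integral>\<^bsub>Q w\<^esub> \<bar>f\<bar>\<^sup>\<sigma>)\<^bsup>p/\<sigma>\<^esup>\<close> over \<open>w\<close> near \<open>z\<close>.  Multiplying these bounds, integrating over each
  Whitney cube, and using the bounded overlap of the enlarged cubes together with
  \<open>\<Sum>\<^sub>k \<Prod>\<^sub>i a\<^sub>i\<^sub>k \<le> \<Prod>\<^sub>i \<Sum>\<^sub>k a\<^sub>i\<^sub>k\<close> shows that (2) implies (1).

  Conversely, (1) is tested on a harmonic function with a pole of high order at the reflection
  \<open>(y, -s)\<close> of a point \<open>(y, s)\<close>.  It decays so fast that the right-hand side is a multiple of the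
  expected power of \<open>s\<close>, and it is bounded below on a small ball around \<open>(y, s)\<close>; boundedly many
  such balls cover a Whitney cube.
\<close>

subsection \<open>Harmonic functions\<close>

text \<open>No surface integrals are used. The mean value property carries the compactly supported
  weight \<open>bump\<close>, so that integrating by parts needs only translation invariance of the
  integral over a box. Later steps need just an upper bound by an unweighted average, with a
  constant depending on the dimension alone.

  The exponent e has two sources: p (d + \<alpha>) / \<sigma> is the scaling of an integral over a
  cube Q_w raised to the power p / \<sigma>, and the other d is the volume of the set of points w
  over which that bound is averaged.

  The constants in the Whitney condition are arbitrary, so a dilation by 5/4 need not contain the
  balls of radius t / 8 around the points of a cube. The role of the enlarged cubes is taken by
  \<open>whitney_neighbourhood\<close>, whose size is adapted to the given decomposition.

  In the converse a single function fills all m slots, so its decay exponent M must meet the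
  finitely many conditions e_i < M p_i at once. A Kelvin transform makes harmonicity, homogeneity
  and size explicit, and homogeneity reduces the lower bound at every height to continuity at one
  point.\<close>

lemma differentiable_on_frechet_derivative:
  assumes "f differentiable_on S" "open S" "z \<in> S"
  shows "(f has_derivative frechet_derivative f (at z)) (at z)"
  using assms at_within_open differentiable_on_def frechet_derivative_works by metis

lemma harmonic_onD:
  fixes f :: "'a::euclidean_space \<Rightarrow> real"
  assumes "harmonic_on f S"
  shows "open S"
    and "z \<in> S \<Longrightarrow> (f has_derivative frechet_derivative f (at z)) (at z)"
    and "z \<in> S \<Longrightarrow> b \<in> Basis \<Longrightarrow>
      (partial_deriv b f has_derivative frechet_derivative (partial_deriv b f) (at z)) (at z)"
    and "b \<in> Basis \<Longrightarrow> c \<in> Basis \<Longrightarrow> continuous_on S (partial_deriv c (partial_deriv b f))"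
    and "z \<in> S \<Longrightarrow> (\<Sum>b\<in>Basis. partial_deriv b (partial_deriv b f) z) = 0"
  using assms differentiable_on_frechet_derivative[of _ S]
  by (auto simp: harmonic_on_def numeral_2_eq_2 laplacian_def)

lemma harmonic_on_imp_continuous_on:
  fixes f :: "'a::euclidean_space \<Rightarrow> real"
  assumes "harmonic_on f S"
  shows "continuous_on S f"
  using assms by (auto simp: harmonic_on_def numeral_2_eq_2 intro: differentiable_imp_continuous_on)

text \<open>\<open>partial_deriv\<close> goes through the choice-based
  \<open>frechet_derivative\<close>. Uniqueness of derivatives on the open set \<open>S\<close> lets
  explicit first and second derivatives take its place, which is how \<open>kelvin\<close> is shown
  to be harmonic.\<close>

lemma harmonic_onI:
  fixes f :: "'a::euclidean_space \<Rightarrow> real"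
  assumes S: "open S"
    and f: "\<And>z. z \<in> S \<Longrightarrow> (f has_derivative f' z) (at z)"
    and f': "\<And>z b. z \<in> S \<Longrightarrow> b \<in> Basis \<Longrightarrow> ((\<lambda>z. f' z b) has_derivative f'' b z) (at z)"
    and cont: "\<And>b c. b \<in> Basis \<Longrightarrow> c \<in> Basis \<Longrightarrow> continuous_on S (\<lambda>z. f'' b z c)"
    and zero: "\<And>z. z \<in> S \<Longrightarrow> (\<Sum>b\<in>Basis. f'' b z b) = 0"
  shows "harmonic_on f S"
proof -
  have 1: "partial_deriv b f z = f' z b" if "z \<in> S" for b z
    using frechet_derivative_at[OF f[OF that]] by (simp add: partial_deriv_def)
  have 2: "(partial_deriv b f has_derivative f'' b z) (at z)" if "z \<in> S" "b \<in> Basis" for b z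
    by (rule has_derivative_transform_within_open[OF f'[OF that] S that(1)]) (simp add: 1)
  have 3: "partial_deriv c (partial_deriv b f) z = f'' b z c" if "z \<in> S" "b \<in> Basis" for b c z
    using frechet_derivative_at[OF 2[OF that]] by (simp add: partial_deriv_def)
  have "continuous_on S (partial_deriv c (partial_deriv b f))" if "b \<in> Basis" "c \<in> Basis" for b c
    using cont[OF that] by (simp add: 3 that cong: continuous_on_cong)
  moreover have "f differentiable_on S" "\<And>b. b \<in> Basis \<Longrightarrow> partial_deriv b f differentiable_on S"
    using f 2 S by (auto simp: differentiable_on_eq_differentiable_at differentiable_def)
  ultimately show ?thesis
    using S zero by (simp add: harmonic_on_def numeral_2_eq_2 laplacian_def 3)
qed

lemma frechet_derivative_eq_sum_partial_deriv:
  fixes f :: "'a::euclidean_space \<Rightarrow> real"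
  assumes "f differentiable at z"
  shows "frechet_derivative f (at z) v = (\<Sum>b\<in>Basis. (v \<bullet> b) * partial_deriv b f z)"
proof -
  interpret linear "frechet_derivative f (at z)"
    by (rule linear_frechet_derivative[OF assms])
  have "frechet_derivative f (at z) v = frechet_derivative f (at z) (\<Sum>b\<in>Basis. (v \<bullet> b) *\<^sub>R b)"
    by (simp add: euclidean_representation)
  then show ?thesis
    by (simp add: sum scale partial_deriv_def)
qed

text \<open>Integration by parts without boundary term. Translating \<open>g\<close> in the
  direction \<open>b\<close> leaves its total integral unchanged; differentiating under the integral
  sign at translation 0 gives the claim.\<close>

lemma integral_directional_derivative_eq_0:
  fixes g :: "'a::euclidean_space \<Rightarrow> real"
  assumes g: "\<And>x. (g has_derivative g' x) (at x)"
    and cont: "continuous_on UNIV (\<lambda>x. g' x b)"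
    and b: "b \<in> Basis"
    and supp: "\<And>x. x \<notin> cbox a c \<Longrightarrow> g x = 0"
  shows "integral (cbox a c) (\<lambda>x. g' x b) = 0"
proof -
  \<comment> \<open>The box grows by 1 on every side, so that for |h| at most 1 the translated
    support stays inside it and \<open>F\<close> is constant near 0.\<close>
  define F where "F h = integral (cbox (a - One) (c + One)) (\<lambda>y. g (y + h *\<^sub>R b))" for h
  have gcont: "continuous_on UNIV g"
    using g by (meson has_derivative_at_withinI has_derivative_continuous_on)
  have sub: "cbox a c \<subseteq> cbox (a - One + h *\<^sub>R b) (c + One + h *\<^sub>R b)" if "\<bar>h\<bar> \<le> 1" for h
    unfolding subset_box
  proof (intro impI ballI)
    fix i :: 'a assume i: "i \<in> Basis"
    show "(a - One + h *\<^sub>R b) \<bullet> i \<le> a \<bullet> i \<and> c \<bullet> i \<le> (c + One + h *\<^sub>R b) \<bullet> i"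
      using that i b by (auto simp: inner_simps inner_Basis)
  qed
  have F_const: "F h = integral (cbox a c) g" if "\<bar>h\<bar> \<le> 1" for h
  proof -
    have "g integrable_on cbox a c"
      by (rule integrable_continuous) (use gcont continuous_on_subset in blast)
    then have "(g has_integral integral (cbox a c) g) (cbox (a - One + h *\<^sub>R b) (c + One + h *\<^sub>R b))"
      by (intro has_integral_on_superset[OF integrable_integral _ sub[OF that]]) (auto simp: supp)
    then show ?thesis
      unfolding F_def
      using integral_shift_cbox_plus[of "a - One" "c + One" g "h *\<^sub>R b"]
      by (simp add: o_def add.commute integral_unique)
  qed
  have "(F has_field_derivative integral (cbox (a - One) (c + One)) (\<lambda>y. g' (y + 0 *\<^sub>R b) b))
          (at 0 within UNIV)"
    unfolding F_def
  proof (rule leibniz_rule_field_derivative[where fx="\<lambda>h y. g' (y + h *\<^sub>R b) b"])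
    fix h :: real and y :: 'a
    interpret bounded_linear "g' (y + h *\<^sub>R b)" using g has_derivative_bounded_linear by blast
    have "((\<lambda>h. g (y + h *\<^sub>R b)) has_derivative (\<lambda>k. g' (y + h *\<^sub>R b) (k *\<^sub>R b))) (at h)"
      by (rule has_derivative_compose[OF _ g]) (auto intro!: derivative_eq_intros)
    then show "((\<lambda>h. g (y + h *\<^sub>R b)) has_real_derivative g' (y + h *\<^sub>R b) b) (at h within UNIV)"
      by (simp add: has_field_derivative_def scaleR mult_commute_abs)
  next
    show "(\<lambda>y. g (y + h *\<^sub>R b)) integrable_on cbox (a - One) (c + One)" for h
      by (intro integrable_continuous continuous_on_compose2[OF gcont]) (auto intro!: continuous_intros)
  next
    show "continuous_on (UNIV \<times> cbox (a - One) (c + One)) (\<lambda>(h, y). g' (y + h *\<^sub>R b) b)"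
      unfolding split_def
      by (intro continuous_on_compose2[OF cont]) (auto intro!: continuous_intros)
  qed auto
  then have D: "(F has_field_derivative integral (cbox (a - One) (c + One)) (\<lambda>y. g' y b)) (at 0)"
    by simp
  have "(F has_field_derivative 0) (at 0)"
    by (rule has_field_derivative_transform_within_open[where f="\<lambda>_. integral (cbox a c) g" and S="{-1<..<1}"])
      (auto simp: F_const)
  with D have 0: "integral (cbox (a - One) (c + One)) (\<lambda>y. g' y b) = 0"
    by (rule DERIV_unique)
  have g'0: "g' x b = 0" if "x \<notin> cbox a c" for x
  proof -
    have "(g has_derivative (\<lambda>_. 0)) (at x)"
      by (rule has_derivative_transform_within_open[where f="\<lambda>_. 0" and s="- cbox a c"])
        (use that supp in auto)
    with g[of x] have "g' x = (\<lambda>_. 0)" by (rule has_derivative_unique)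
    then show ?thesis by simp
  qed
  have "(\<lambda>y. g' y b) integrable_on cbox a c"
    by (rule integrable_continuous) (use cont continuous_on_subset in blast)
  then have "((\<lambda>y. g' y b) has_integral integral (cbox a c) (\<lambda>y. g' y b)) (cbox (a - One) (c + One))"
    by (intro has_integral_on_superset[OF integrable_integral]) (use sub[of 0] in \<open>auto simp: g'0\<close>)
  with 0 show ?thesis by (simp add: integral_unique)
qed

subsection \<open>The mean value property\<close>

text \<open>A cut-off for the unit ball which is itself only Lipschitz, but whose square is
  continuously differentiable; this is enough smoothness for one integration by parts. Vanishing off
  the ball, it allows all integrals to run over a cube.\<close>

definition bump :: "'a::euclidean_space \<Rightarrow> real" where
  "bump y = max 0 (1 - y \<bullet> y)"

lemma continuous_on_bump [continuous_intros]:
  "continuous_on S g \<Longrightarrow> continuous_on S (\<lambda>x. bump (g x))"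
  unfolding bump_def by (intro continuous_intros)

lemma bump_bounds: "0 \<le> bump y" "bump y \<le> 1"
  by (auto simp: bump_def)

lemma bump_eq_0: "y \<notin> cball 0 1 \<Longrightarrow> bump y = 0"
  using power_mono[of 1 "norm y" 2] by (simp add: bump_def dot_square_norm)

lemma cball_subset_cbox_One: "cball (0::'a::euclidean_space) 1 \<subseteq> cbox (- One) One"
proof
  fix y :: 'a assume y: "y \<in> cball 0 1"
  have "\<bar>y \<bullet> b\<bar> \<le> 1" if "b \<in> Basis" for b
    using Basis_le_norm[OF that, of y] y by simp
  then show "y \<in> cbox (- One) One"
    by (force simp: mem_box abs_le_iff)
qed

lemma has_real_derivative_max_0_power2:
  "((\<lambda>s::real. (max 0 s)\<^sup>2) has_real_derivative 2 * max 0 s) (at s)"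
proof (cases s "0::real" rule: linorder_cases)
  case less
  have "((\<lambda>s. (max 0 s)\<^sup>2) has_real_derivative 0) (at s)"
    by (rule has_field_derivative_transform_within_open[where f="\<lambda>_. 0" and S="{..<0}"])
      (use less in auto)
  then show ?thesis using less by simp
next
  case equal
  have "(\<lambda>h::real. (max 0 h)\<^sup>2 / h) \<midarrow>0\<rightarrow> 0"
  proof (rule Lim_null_comparison)
    show "\<forall>\<^sub>F h in at 0. norm ((max 0 h)\<^sup>2 / h) \<le> \<bar>h\<bar>"
      by (auto simp: max_def power2_eq_square intro!: always_eventually)
    show "((\<lambda>h::real. \<bar>h\<bar>) \<longlongrightarrow> 0) (at 0)"
      by (auto intro!: tendsto_eq_intros)
  qed
  then show ?thesis using equal by (simp add: DERIV_def)
next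
  case greater
  have "((\<lambda>s. (max 0 s)\<^sup>2) has_real_derivative 2 * s) (at s)"
    by (rule has_field_derivative_transform_within_open[where f="\<lambda>s. s\<^sup>2" and S="{0<..}"])
      (use greater in \<open>auto intro!: derivative_eq_intros\<close>)
  then show ?thesis using greater by simp
qed

lemma has_derivative_bump_power2:
  "((\<lambda>y. (bump y)\<^sup>2) has_derivative (\<lambda>v. - 4 * bump y * (y \<bullet> v))) (at (y::'a::euclidean_space))"
proof -
  have "((\<lambda>y. 1 - y \<bullet> y) has_derivative (\<lambda>v. - 2 * (y \<bullet> v))) (at y)"
    by (auto intro!: derivative_eq_intros simp: inner_commute)
  from has_derivative_compose[OF this has_real_derivative_max_0_power2[unfolded has_field_derivative_def]]
  show ?thesis by (simp add: bump_def mult.assoc)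
qed

text \<open>
  The radial derivative of the weighted average is the average of
  \<open>\<nabla>f(z + ry) \<bullet> y bump y\<close>.  As \<open>-4 y bump y\<close> is the gradient of \<open>bump\<^sup>2\<close>, it is
  a multiple of the integral of \<open>bump\<^sup>2 \<Delta>f\<close> up to a divergence.
\<close>

lemma harmonic_bump_mean_value:
  fixes f :: "'a::euclidean_space \<Rightarrow> real"
  assumes harm: "harmonic_on f S" and R: "R > 0"
    and sub: "\<And>y. y \<in> cbox (- One) One \<Longrightarrow> z + R *\<^sub>R y \<in> S"
  shows "f z * integral (cbox (- One) One) (bump :: 'a \<Rightarrow> real) =
    integral (cbox (- One) One) (\<lambda>y. f (z + R *\<^sub>R y) * bump y)"
proof -
  let ?B = "cbox (- One) One :: 'a set"
  define F where "F r = integral ?B (\<lambda>y. f (z + r *\<^sub>R y) * bump y)" for r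
  define D where "D r y = (\<Sum>b\<in>Basis. (y \<bullet> b) * partial_deriv b f (z + r *\<^sub>R y)) * bump y" for r y
  note h = harmonic_onD[OF harm]
  \<comment> \<open>The hypothesis speaks of radius \<open>R\<close> only. Shrinking
    \<open>y\<close> by the factor r / R keeps it in the cube, which gives all smaller
    radii.\<close>
  have S: "z + r *\<^sub>R y \<in> S" if "0 \<le> r" "r \<le> R" "y \<in> ?B" for r y
  proof -
    have "(r / R) *\<^sub>R y \<in> ?B"
      unfolding mem_box
    proof
      fix i :: 'a assume i: "i \<in> Basis"
      have "\<bar>y \<bullet> i\<bar> \<le> 1" using that i by (force simp: mem_box)
      then have "\<bar>(r / R) * (y \<bullet> i)\<bar> \<le> 1" unfolding abs_mult
        using that R by (intro mult_le_one) auto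
      then have "- 1 \<le> (r / R) * (y \<bullet> i)" "(r / R) * (y \<bullet> i) \<le> 1" by linarith+
      then show "- One \<bullet> i \<le> (r / R) *\<^sub>R y \<bullet> i \<and> (r / R) *\<^sub>R y \<bullet> i \<le> One \<bullet> i"
        using i by simp
    qed
    from sub[OF this] show ?thesis using R by simp
  qed
  have fc: "continuous_on S f" using harm by (rule harmonic_on_imp_continuous_on)
  have dc: "continuous_on S (partial_deriv b f)" if "b \<in> Basis" for b
    by (rule has_derivative_continuous_on) (use h(3) that has_derivative_at_withinI in blast)
  have DF: "(F has_field_derivative integral ?B (D r)) (at r within {0..R})" if r: "r \<in> {0..R}" for r
    unfolding F_def
  proof (rule leibniz_rule_field_derivative)
    fix r y assume r: "r \<in> {0..R}" and y: "y \<in> ?B"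
    have d: "f differentiable at (z + r *\<^sub>R y)"
      using h(2) S r y by (auto simp: differentiable_def)
    have "((\<lambda>r. f (z + r *\<^sub>R y)) has_derivative
       (\<lambda>k. frechet_derivative f (at (z + r *\<^sub>R y)) (k *\<^sub>R y))) (at r within {0..R})"
      by (rule has_derivative_compose[OF _ h(2)]) (use S r y in \<open>auto intro!: derivative_eq_intros\<close>)
    then have "((\<lambda>r. f (z + r *\<^sub>R y)) has_field_derivative
       (\<Sum>b\<in>Basis. (y \<bullet> b) * partial_deriv b f (z + r *\<^sub>R y))) (at r within {0..R})"
      by (simp add: has_field_derivative_def frechet_derivative_eq_sum_partial_deriv[OF d]
          mult.assoc flip: sum_distrib_left) (simp add: mult_commute_abs)
    then show "((\<lambda>r. f (z + r *\<^sub>R y) * bump y) has_field_derivative D r y) (at r within {0..R})"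
      unfolding D_def by (rule DERIV_cmult_right)
  next
    show "(\<lambda>y. f (z + r *\<^sub>R y) * bump y) integrable_on ?B" if "r \<in> {0..R}" for r
      using that S
      by (intro integrable_continuous continuous_intros continuous_on_compose2[OF fc]) auto
  next
    show "continuous_on ({0..R} \<times> ?B) (\<lambda>(r, y). D r y)"
      unfolding D_def split_def using S
      by (intro continuous_intros continuous_on_compose2[OF dc]) auto
  qed (use r in auto)
  have "integral ?B (D r) = 0" if r: "r \<in> {0..R}" for r
  proof -
    define g' where "g' b y v = r * frechet_derivative (partial_deriv b f) (at (z + r *\<^sub>R y)) v * (bump y)\<^sup>2
        - 4 * partial_deriv b f (z + r *\<^sub>R y) * bump y * (y \<bullet> v)" for b y v :: 'a
    have T: "open ((\<lambda>y. z + r *\<^sub>R y) -` S)"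
      by (intro continuous_open_vimage h continuous_intros)
    \<comment> \<open>Outside \<open>S\<close> the derivatives of \<open>f\<close> are arbitrary
      values, but there the bump vanishes. Two open sets cover the space: on one \<open>f\<close> is
      smooth, on the other everything is 0, so \<open>g'\<close> is a continuous derivative
      globally.\<close>
    have cov: "UNIV = (\<lambda>y. z + r *\<^sub>R y) -` S \<union> - cball 0 1"
      using S[of r] cball_subset_cbox_One r by fastforce
    have g'_cont: "continuous_on UNIV (\<lambda>y. g' b y b)" if b: "b \<in> Basis" for b
      unfolding cov
    proof (rule continuous_on_open_Un[OF T])
      show "continuous_on ((\<lambda>y. z + r *\<^sub>R y) -` S) (\<lambda>y. g' b y b)"
        unfolding g'_def partial_deriv_def[of b "partial_deriv b f", symmetric]
        by (intro continuous_intros continuous_on_compose2[OF dc] continuous_on_compose2[OF h(4)] b) auto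
      show "continuous_on (- cball 0 1) (\<lambda>y. g' b y b)"
        by (rule continuous_on_cong[THEN iffD2, OF refl _ continuous_on_const[of _ 0]])
          (auto simp: g'_def bump_eq_0)
    qed auto
    have g': "((\<lambda>y. partial_deriv b f (z + r *\<^sub>R y) * (bump y)\<^sup>2) has_derivative g' b y) (at y)"
      if b: "b \<in> Basis" for b y
    proof (cases "z + r *\<^sub>R y \<in> S")
      case True
      have "((\<lambda>y. partial_deriv b f (z + r *\<^sub>R y)) has_derivative
         (\<lambda>v. frechet_derivative (partial_deriv b f) (at (z + r *\<^sub>R y)) (r *\<^sub>R v))) (at y)"
        by (rule has_derivative_compose[OF _ h(3)]) (use True b in \<open>auto intro!: derivative_eq_intros\<close>)
      moreover have "linear (frechet_derivative (partial_deriv b f) (at (z + r *\<^sub>R y)))"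
        using h(3)[OF True b] by (rule has_derivative_linear)
      ultimately have "((\<lambda>y. partial_deriv b f (z + r *\<^sub>R y)) has_derivative
         (\<lambda>v. r * frechet_derivative (partial_deriv b f) (at (z + r *\<^sub>R y)) v)) (at y)"
        by (simp add: linear_cmul)
      from has_derivative_mult[OF this has_derivative_bump_power2]
      show ?thesis by (rule has_derivative_eq_rhs) (auto simp: g'_def algebra_simps)
    next
      case False
      then have y: "y \<in> - cball 0 1" using cov by blast
      have "g' b y = (\<lambda>_. 0)" using y by (auto simp: g'_def bump_eq_0)
      moreover have "((\<lambda>y. partial_deriv b f (z + r *\<^sub>R y) * (bump y)\<^sup>2) has_derivative (\<lambda>_. 0)) (at y)"
        by (rule has_derivative_transform_within_open[where f="\<lambda>_. 0" and s="- cball 0 1"])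
          (use y in \<open>auto simp: bump_eq_0\<close>)
      ultimately show ?thesis by simp
    qed
    have zero: "integral ?B (\<lambda>y. g' b y b) = 0" if b: "b \<in> Basis" for b
      using cball_subset_cbox_One
      by (intro integral_directional_derivative_eq_0[OF g' g'_cont] b) (force simp: bump_eq_0)
    have "0 = integral ?B (\<lambda>y. \<Sum>b\<in>Basis. g' b y b)"
      by (subst integral_sum)
        (auto simp: zero intro!: integrable_continuous continuous_on_subset[OF g'_cont])
    also have "\<dots> = integral ?B (\<lambda>y. - 4 * D r y)"
    proof (rule integral_cong)
      fix y :: 'a assume y: "y \<in> ?B"
      have "(\<Sum>b\<in>Basis. g' b y b) =
        r * (bump y)\<^sup>2 * (\<Sum>b\<in>Basis. partial_deriv b (partial_deriv b f) (z + r *\<^sub>R y)) - 4 * D r y"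
        by (simp add: g'_def D_def partial_deriv_def sum_subtractf sum_distrib_left sum_distrib_right mult_ac)
      then show "(\<Sum>b\<in>Basis. g' b y b) = - 4 * D r y"
        using h(5) S r y by simp
    qed
    finally show ?thesis by simp
  qed
  then have "\<exists>c. \<forall>r\<in>{0..R}. F r = c"
    using DF by (intro has_field_derivative_zero_constant) auto
  then have "F 0 = F R" using R by force
  then show ?thesis by (simp add: F_def)
qed

lemma integral_bump_pos: "0 < integral (cbox (- One) One) (bump :: 'a::euclidean_space \<Rightarrow> real)"
proof -
  let ?B = "cbox (- One) One :: 'a set"
  have c: "continuous_on ?B bump"
    by (intro continuous_intros)
  then have i: "bump integrable_on ?B" by (rule integrable_continuous)
  have "0 \<le> integral ?B bump"
    by (intro integral_nonneg i) (simp add: bump_bounds)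
  moreover have "integral ?B bump \<noteq> 0"
  proof
    assume "integral ?B bump = 0"
    then have "(bump has_integral 0) ?B" using i by (metis integrable_integral)
    then have "bump (0::'a) = 0"
      by (intro has_integral_0_cbox_imp_0[OF c]) (auto simp: bump_bounds mem_box box_ne_empty)
    then show False by (simp add: bump_def)
  qed
  ultimately show ?thesis by linarith
qed

text \<open>Passage from the gauge integral, in which the mean value identity is derived, to the
  nonnegative Lebesgue integral, which the estimates need because their right-hand sides may be
  infinite.\<close>

lemma set_nn_integral_continuous_on_cbox:
  fixes f :: "'a::euclidean_space \<Rightarrow> real"
  assumes f: "continuous_on (cbox a b) f" and nn: "\<And>x. x \<in> cbox a b \<Longrightarrow> 0 \<le> f x"
  shows "(\<integral>\<^sup>+x\<in>cbox a b. ennreal (f x) \<partial>lborel) = ennreal (integral (cbox a b) f)"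
proof -
  have "(\<integral>\<^sup>+x. ennreal (indicator (cbox a b) x * f x) \<partial>lborel) = ennreal (integral (cbox a b) f)"
  proof (rule nn_integral_has_integral_lborel)
    show "(\<lambda>x. indicator (cbox a b) x * f x) \<in> borel_measurable borel"
      using borel_measurable_continuous_on_indicator[OF _ f] by simp
    have "((\<lambda>x. if x \<in> cbox a b then f x else 0) has_integral integral (cbox a b) f) UNIV"
      unfolding has_integral_restrict_UNIV using f by (simp add: integrable_continuous integrable_integral)
    moreover have "(\<lambda>x. indicator (cbox a b) x * f x) = (\<lambda>x. if x \<in> cbox a b then f x else 0)"
      by (auto simp: indicator_def)
    ultimately show "((\<lambda>x. indicator (cbox a b) x * f x) has_integral integral (cbox a b) f) UNIV"
      by simp
  qed (auto simp: indicator_def nn)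
  moreover have "(\<integral>\<^sup>+x\<in>cbox a b. ennreal (f x) \<partial>lborel) =
      (\<integral>\<^sup>+x. ennreal (indicator (cbox a b) x * f x) \<partial>lborel)"
    by (intro nn_integral_cong) (auto simp: indicator_def)
  ultimately show ?thesis by simp
qed

text \<open>The weighted mean value identity is applied on a cube inscribed in the ball, and the
  weight is then dropped because it is at most 1.\<close>

lemma harmonic_abs_le_average:
  "\<exists>C>0. \<forall>(f :: 'a::euclidean_space \<Rightarrow> real) S z r. harmonic_on f S \<longrightarrow> 0 < r \<longrightarrow> cball z r \<subseteq> S \<longrightarrow>
     ennreal (\<bar>f z\<bar> * r ^ DIM('a)) \<le> ennreal C * (\<integral>\<^sup>+w\<in>cball z r. ennreal \<bar>f w\<bar> \<partial>lborel)"
proof -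
  define c0 where "c0 = integral (cbox (- One) One) (bump :: 'a \<Rightarrow> real)"
  have c0: "c0 > 0" unfolding c0_def by (rule integral_bump_pos)
  \<comment> \<open>The divisor \<open>c0\<close> is the mass of the weight; the numerator comes
    from r = d R, with R the half side of the inscribed cube and d the dimension.\<close>
  define C where "C = real DIM('a) ^ DIM('a) / c0"
  have "C > 0" using c0 by (simp add: C_def)
  moreover have "ennreal (\<bar>f z\<bar> * r ^ DIM('a)) \<le> ennreal C * (\<integral>\<^sup>+w\<in>cball z r. ennreal \<bar>f w\<bar> \<partial>lborel)"
    if f: "harmonic_on f S" and r: "0 < r" and sub: "cball z r \<subseteq> S"
    for f :: "'a \<Rightarrow> real" and S z r
  proof -
    let ?B = "cbox (- One) One :: 'a set"
    \<comment> \<open>The norm is at most the sum of the d coordinates in absolute value, so a cube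
      of half side r / d fits into the ball of radius r.\<close>
    define R where "R = r / real DIM('a)"
    have R: "R > 0" using r by (simp add: R_def)
    define Q where "Q = cbox (z - R *\<^sub>R One) (z + R *\<^sub>R One)"
    have Q: "Q \<subseteq> cball z r"
    proof
      fix w assume w: "w \<in> Q"
      have "\<bar>(w - z) \<bullet> b\<bar> \<le> R" if "b \<in> Basis" for b
        using w that by (auto simp: Q_def mem_box inner_simps abs_le_iff algebra_simps)
      then have "(\<Sum>b\<in>Basis. \<bar>(w - z) \<bullet> b\<bar>) \<le> (\<Sum>b\<in>(Basis::'a set). R)" by (rule sum_mono)
      also have "\<dots> = r" by (simp add: R_def)
      finally have "norm (w - z) \<le> r" using norm_le_l1[of "w - z"] by linarith
      then show "w \<in> cball z r" by (simp add: dist_norm norm_minus_commute)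
    qed
    have Qimg: "z + R *\<^sub>R y \<in> Q" if "y \<in> ?B" for y
      unfolding Q_def mem_box
    proof
      fix i :: 'a assume i: "i \<in> Basis"
      have "- 1 \<le> y \<bullet> i" "y \<bullet> i \<le> 1"
        using that i by (auto simp: mem_box)
      then have "R * - 1 \<le> R * (y \<bullet> i)" "R * (y \<bullet> i) \<le> R * 1"
        using R by (simp_all only: mult_le_cancel_left_pos)
      then show "(z - R *\<^sub>R One) \<bullet> i \<le> (z + R *\<^sub>R y) \<bullet> i \<and> (z + R *\<^sub>R y) \<bullet> i \<le> (z + R *\<^sub>R One) \<bullet> i"
        using i by (simp add: inner_simps)
    qed
    have fc: "continuous_on S f" using f by (rule harmonic_on_imp_continuous_on)
    have fQ: "continuous_on Q (\<lambda>w. \<bar>f w\<bar>)"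
      by (intro continuous_intros continuous_on_subset[OF fc]) (use Q sub in auto)
    have fB: "continuous_on ?B (\<lambda>y. f (z + R *\<^sub>R y))"
      using Qimg Q sub by (intro continuous_on_compose2[OF fc] continuous_intros) auto
    define I where "I = integral Q (\<lambda>w. \<bar>f w\<bar>)"
    have "((\<lambda>w. \<bar>f w\<bar>) has_integral I) (cbox (z - R *\<^sub>R One) (z + R *\<^sub>R One))"
      unfolding I_def Q_def[symmetric]
      using fQ by (simp add: integrable_continuous integrable_integral Q_def)
    from has_integral_affinity'[OF this R, of z]
    have "((\<lambda>y. \<bar>f (z + R *\<^sub>R y)\<bar>) has_integral I / R ^ DIM('a)) ?B"
      using R by (simp add: add.commute divide_inverse mult.commute)
    then have I: "integral ?B (\<lambda>y. \<bar>f (z + R *\<^sub>R y)\<bar>) = I / R ^ DIM('a)" by (rule integral_unique)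
    have "f z * c0 = integral ?B (\<lambda>y. f (z + R *\<^sub>R y) * bump y)"
      unfolding c0_def using Qimg Q sub by (intro harmonic_bump_mean_value[OF f R]) blast
    then have "\<bar>f z\<bar> * c0 = norm (integral ?B (\<lambda>y. f (z + R *\<^sub>R y) * bump y))"
      using c0 by (simp flip: \<open>f z * c0 = _\<close> add: abs_mult)
    also have "\<dots> \<le> integral ?B (\<lambda>y. \<bar>f (z + R *\<^sub>R y)\<bar>)"
    proof (rule Henstock_Kurzweil_Integration.integral_norm_bound_integral)
      show "norm (f (z + R *\<^sub>R y) * bump y) \<le> \<bar>f (z + R *\<^sub>R y)\<bar>" for y
        using bump_bounds[of y] by (simp add: abs_mult mult_left_le)
    qed (intro integrable_continuous continuous_intros fB)+
    finally have "\<bar>f z\<bar> * c0 * R ^ DIM('a) \<le> I"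
      using R unfolding I by (simp add: field_simps)
    then have "\<bar>f z\<bar> * r ^ DIM('a) \<le> C * I"
      using c0 by (simp add: C_def R_def power_divide field_simps)
    then have "ennreal (\<bar>f z\<bar> * r ^ DIM('a)) \<le> ennreal (C * I)" by (rule ennreal_leI)
    also have "\<dots> = ennreal C * ennreal I"
      using \<open>C > 0\<close> by (simp add: ennreal_mult')
    also have "ennreal I = (\<integral>\<^sup>+w\<in>Q. ennreal \<bar>f w\<bar> \<partial>lborel)"
      unfolding I_def Q_def by (rule set_nn_integral_continuous_on_cbox[symmetric])
        (use fQ in \<open>auto simp: Q_def\<close>)
    also have "\<dots> \<le> (\<integral>\<^sup>+w\<in>cball z r. ennreal \<bar>f w\<bar> \<partial>lborel)"
      using Q by (intro nn_integral_mono mult_left_mono) (auto simp: indicator_def)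
    finally show ?thesis by (simp add: mult_left_mono)
  qed
  ultimately show ?thesis by blast
qed

subsection \<open>Mean value bounds for powers\<close>

lemma borel_measurable_powr_indicator:
  fixes u :: "'a::euclidean_space \<Rightarrow> real"
  assumes "continuous_on A u" "A \<in> sets borel" "0 < q"
  shows "(\<lambda>x. ennreal (u x powr q) * indicator A x) \<in> borel_measurable borel"
proof -
  have [measurable]: "(\<lambda>x. indicator A x *\<^sub>R u x) \<in> borel_measurable borel"
    using assms by (intro borel_measurable_continuous_on_indicator)
  have "(\<lambda>x. ennreal ((indicator A x *\<^sub>R u x) powr q)) \<in> borel_measurable borel"
    by measurable
  moreover have "(\<lambda>x. ennreal ((indicator A x *\<^sub>R u x) powr q)) = (\<lambda>x. ennreal (u x powr q) * indicator A x)"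
    using assms by (auto simp: indicator_def fun_eq_iff)
  ultimately show ?thesis by (simp only:)
qed

text \<open>Values of \<open>u\<close> below a level t contribute at most half of the left-hand side
  of \<open>mean\<close> and are absorbed there. Above t, the exponent 1 - q is not positive, so u
  is at most t^(1-q) u^q.\<close>

lemma powr_mean_bound_ge_1:
  fixes u :: "'a::euclidean_space \<Rightarrow> real"
  assumes q: "1 \<le> q" and C: "0 < C" and r: "0 < r"
    and cont: "continuous_on (cball z r) u" and nn: "\<And>w. w \<in> cball z r \<Longrightarrow> 0 \<le> u w"
    and mean: "ennreal (u z * r ^ DIM('a)) \<le> ennreal C * (\<integral>\<^sup>+w\<in>cball z r. ennreal (u w) \<partial>lborel)"
  shows "ennreal (u z powr q * r ^ DIM('a)) \<le>
    ennreal (2 * C * (2 * C * unit_ball_vol DIM('a)) powr (q - 1)) *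
      (\<integral>\<^sup>+w\<in>cball z r. ennreal (u w powr q) \<partial>lborel)"
proof (cases "u z = 0")
  case False
  let ?I = "\<integral>\<^sup>+w\<in>cball z r. ennreal (u w powr q) \<partial>lborel"
  define V where "V = unit_ball_vol DIM('a)"
  define X where "X = r ^ DIM('a)"
  have pos: "u z > 0" "V > 0" "X > 0"
    using False nn[of z] r by (auto simp: V_def X_def)
  \<comment> \<open>Chosen so that C times the integral of the constant t over the ball, namely C t
    V X, is exactly u z X / 2.\<close>
  define t where "t = u z / (2 * C * V)"
  have t: "t > 0" using pos C by (simp add: t_def)
  have split: "u w \<le> t + t powr (1 - q) * u w powr q" if w: "w \<in> cball z r" for w
  proof (cases "u w \<le> t")
    case True
    then show ?thesis by (simp add: add_increasing2)
  next
    case False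
    then have uw: "u w > 0" using t by linarith
    have "u w = u w powr (1 - q) * u w powr q"
      using uw by (simp flip: powr_add)
    also have "\<dots> \<le> t powr (1 - q) * u w powr q"
      using False t q by (intro mult_right_mono powr_mono2') auto
    finally show ?thesis using t by linarith
  qed
  have [measurable]: "cball z r \<in> sets borel" by (rule borel_closed[OF closed_cball])
  have M1: "(\<lambda>w. ennreal t * indicator (cball z r) w) \<in> borel_measurable borel"
    by measurable
  have M2: "(\<lambda>w. ennreal (u w powr q) * indicator (cball z r) w) \<in> borel_measurable borel"
    using q by (intro borel_measurable_powr_indicator cont) auto
  have "(\<integral>\<^sup>+w\<in>cball z r. ennreal (u w) \<partial>lborel) \<le>
    (\<integral>\<^sup>+w. ennreal t * indicator (cball z r) w +
        ennreal (t powr (1 - q)) * (ennreal (u w powr q) * indicator (cball z r) w) \<partial>lborel)"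
  proof (rule nn_integral_mono)
    fix w
    have "ennreal (u w) \<le> ennreal t + ennreal (t powr (1 - q)) * ennreal (u w powr q)" if "w \<in> cball z r"
      using ennreal_leI[OF split[OF that]] t by (simp add: ennreal_plus ennreal_mult)
    then show "ennreal (u w) * indicator (cball z r) w \<le> ennreal t * indicator (cball z r) w +
        ennreal (t powr (1 - q)) * (ennreal (u w powr q) * indicator (cball z r) w)"
      by (auto simp: indicator_def)
  qed
  also have "\<dots> = ennreal t * emeasure lborel (cball z r) + ennreal (t powr (1 - q)) * ?I"
    using M1 M2 by (subst nn_integral_add) (auto simp: nn_integral_cmult nn_integral_cmult_indicator)
  also have "emeasure lborel (cball z r) = ennreal (V * X)"
    using r by (simp add: emeasure_cball V_def X_def)
  finally have le: "ennreal (u z * X) \<le>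
      ennreal C * (ennreal t * ennreal (V * X) + ennreal (t powr (1 - q)) * ?I)"
    using order_trans[OF mean mult_left_mono] by (simp add: X_def)
  \<comment> \<open>Absorbing half of the left-hand side requires real numbers; if the integral of
    u^q is infinite there is nothing to prove.\<close>
  show ?thesis
  proof (cases ?I)
    case (real J)
    have "ennreal (u z * X) \<le> ennreal (C * (t * (V * X) + t powr (1 - q) * J))"
      using le real t pos C
      by (simp add: ennreal_mult ennreal_plus)
    then have "u z * X \<le> C * (t * (V * X) + t powr (1 - q) * J)"
      using real t pos C by (subst (asm) ennreal_le_iff) auto
    also have "\<dots> = u z * X / 2 + C * t powr (1 - q) * J"
      using pos C by (simp add: t_def field_simps)
    finally have "u z * X \<le> 2 * C * t powr (1 - q) * J" by simp
    then have "t powr (q - 1) * (u z * X) \<le> t powr (q - 1) * (2 * C * t powr (1 - q) * J)"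
      by (intro mult_left_mono) auto
    also have "\<dots> = 2 * C * J * (t powr (q - 1) * t powr (1 - q))" by simp
    also have "t powr (q - 1) * t powr (1 - q) = 1"
      using t by (simp flip: powr_add)
    finally have "t powr (q - 1) * u z * X \<le> 2 * C * J" by simp
    moreover have "t powr (q - 1) * u z = u z powr q / (2 * C * V) powr (q - 1)"
    proof -
      have "t powr (q - 1) = u z powr (q - 1) / (2 * C * V) powr (q - 1)"
        using pos C by (simp add: t_def powr_divide)
      moreover have "u z powr (q - 1) * u z = u z powr q"
        using pos powr_mult_base[of "u z" "q - 1"] by (simp add: mult.commute)
      ultimately show ?thesis by simp
    qed
    ultimately have "u z powr q / (2 * C * V) powr (q - 1) * X \<le> 2 * C * J" by simp
    moreover have "(2 * C * V) powr (q - 1) > 0" using pos C by simp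
    ultimately have "u z powr q * X \<le> 2 * C * J * (2 * C * V) powr (q - 1)"
      by (simp add: divide_le_eq)
    then have "u z powr q * X \<le> 2 * C * (2 * C * V) powr (q - 1) * J"
      by (simp add: mult_ac)
    then show ?thesis
      using real C by (simp add: X_def V_def ennreal_leI flip: ennreal_mult)
  next
    case top
    then show ?thesis using C pos by (simp add: ennreal_mult_top flip: V_def)
  qed
qed simp

text \<open>
  The Hardy--Littlewood argument: maximize \<open>u\<^sup>q\<close> times the \<open>d\<close>-th power of the distance to
  the sphere, and apply the mean value bound at the maximum point to \<open>u = u\<^sup>q u\<^sup>1\<^sup>-\<^sup>q\<close>.
\<close>

lemma powr_mean_bound_less_1:
  fixes u :: "'a::euclidean_space \<Rightarrow> real"
  assumes q: "0 < q" "q < 1" and C: "0 < C" and r: "0 < r"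
    and cont: "continuous_on (cball z0 r) u" and nn: "\<And>w. w \<in> cball z0 r \<Longrightarrow> 0 \<le> u w"
    and mean: "\<And>z \<rho>. 0 < \<rho> \<Longrightarrow> cball z \<rho> \<subseteq> cball z0 r \<Longrightarrow>
      ennreal (u z * \<rho> ^ DIM('a)) \<le> ennreal C * (\<integral>\<^sup>+w\<in>cball z \<rho>. ennreal (u w) \<partial>lborel)"
  shows "ennreal (u z0 powr q * r ^ DIM('a)) \<le>
    ennreal (C * 2 powr (DIM('a) / q)) * (\<integral>\<^sup>+w\<in>cball z0 r. ennreal (u w powr q) \<partial>lborel)"
proof -
  let ?I = "\<integral>\<^sup>+w\<in>cball z0 r. ennreal (u w powr q) \<partial>lborel"
  \<comment> \<open>\<open>\<delta>\<close> is the distance to the sphere. The product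
    \<open>g\<close> is continuous on the compact ball, so its maximum exists, and \<open>g\<close>
    at the center is the quantity to be bounded.\<close>
  define \<delta> where "\<delta> w = r - dist w z0" for w
  define g where "g w = u w powr q * \<delta> w ^ DIM('a)" for w
  have "continuous_on (cball z0 r) g"
    unfolding g_def \<delta>_def using q nn
    by (intro continuous_intros continuous_on_powr' cont) auto
  moreover have "z0 \<in> cball z0 r" using r by simp
  ultimately obtain z where z: "z \<in> cball z0 r" and max: "\<And>w. w \<in> cball z0 r \<Longrightarrow> g w \<le> g z"
    using continuous_attains_sup[of "cball z0 r" g] by auto
  define M where "M = g z"
  have gz0: "u z0 powr q * r ^ DIM('a) \<le> M"
    using max[of z0] r by (simp add: M_def g_def \<delta>_def)
  show ?thesis
  \<comment> \<open>The degenerate cases are trivial; otherwise \<open>K\<close> below is positive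
    and can be cancelled at the end.\<close>
  proof (cases "M > 0 \<and> ?I \<noteq> \<infinity>")
    case False
    then consider "\<not> M > 0" | "?I = \<infinity>" by blast
    then show ?thesis
    proof cases
      case 1
      then have "u z0 powr q * r ^ DIM('a) \<le> 0" using gz0 by linarith
      then show ?thesis by (simp add: ennreal_neg)
    next
      case 2
      then show ?thesis using C by (simp add: ennreal_mult_top)
    qed
  next
    case True
    then obtain J where J: "?I = ennreal J" "0 \<le> J" by (cases ?I) auto
    from True have M: "M > 0" by simp
    have uz: "u z > 0"
      using nn[OF z] M q by (cases "u z = 0") (auto simp: M_def g_def)
    have "\<delta> z \<noteq> 0"
    proof
      assume "\<delta> z = 0"
      then have "M = 0" by (simp add: M_def g_def)
      with M show False by simp
    qed
    moreover have "\<delta> z \<ge> 0" using z by (simp add: \<delta>_def dist_commute)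
    ultimately have \<delta>: "\<delta> z > 0" by linarith
    \<comment> \<open>On the ball of this radius around the maximum point, \<open>\<delta>\<close>
      stays at least \<open>\<rho>\<close>. As \<open>\<delta>\<close> at \<open>z\<close> is twice
      \<open>\<rho>\<close>, this costs the factor 2^d in \<open>Mz\<close>.\<close>
    define \<rho> where "\<rho> = \<delta> z / 2"
    have \<rho>: "\<rho> > 0" using \<delta> by (simp add: \<rho>_def)
    define X where "X = \<rho> ^ DIM('a)"
    have X: "X > 0" using \<rho> by (simp add: X_def)
    \<comment> \<open>Maximality gives u^q at most M / X near \<open>z\<close>; the power (1 - q) /
      q turns this into the bound \<open>K\<close> for u^(1-q).\<close>
    define K where "K = (M / X) powr ((1 - q) / q)"
    have \<delta>_ge: "\<rho> \<le> \<delta> w" if "w \<in> cball z \<rho>" for w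
      using that dist_triangle[of w z0 z] by (simp add: \<rho>_def \<delta>_def dist_commute field_simps)
    have sub: "cball z \<rho> \<subseteq> cball z0 r"
    proof
      fix w assume "w \<in> cball z \<rho>"
      from \<delta>_ge[OF this] \<rho> show "w \<in> cball z0 r" by (simp add: \<delta>_def dist_commute)
    qed
    have bound: "u w \<le> K * u w powr q" if w: "w \<in> cball z \<rho>" for w
    proof (cases "u w = 0")
      case False
      then have uw: "u w > 0" using nn w sub by force
      have "u w powr q * X \<le> u w powr q * \<delta> w ^ DIM('a)"
        unfolding X_def using \<delta>_ge[OF w] \<rho> by (intro mult_left_mono power_mono) auto
      also have "\<dots> \<le> M" using max w sub by (auto simp: g_def M_def)
      finally have "u w powr q \<le> M / X" using X by (simp add: field_simps)
      then have "(u w powr q) powr ((1 - q) / q) \<le> K"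
        unfolding K_def using q by (intro powr_mono2) auto
      then have "u w powr (1 - q) \<le> K" using q by (simp add: powr_powr)
      then have "u w powr (1 - q) * u w powr q \<le> K * u w powr q" by (intro mult_right_mono) auto
      then show ?thesis using uw by (simp flip: powr_add)
    qed simp
    have M2: "(\<lambda>w. ennreal (u w powr q) * indicator (cball z0 r) w) \<in> borel_measurable borel"
      using q by (intro borel_measurable_powr_indicator cont) auto
    have "ennreal (u z * X) \<le> ennreal C * (\<integral>\<^sup>+w\<in>cball z \<rho>. ennreal (u w) \<partial>lborel)"
      unfolding X_def using mean[OF \<rho> sub] .
    also have "(\<integral>\<^sup>+w\<in>cball z \<rho>. ennreal (u w) \<partial>lborel) \<le>
        (\<integral>\<^sup>+w. ennreal K * (ennreal (u w powr q) * indicator (cball z0 r) w) \<partial>lborel)"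
    proof (rule nn_integral_mono)
      fix w
      show "ennreal (u w) * indicator (cball z \<rho>) w \<le>
          ennreal K * (ennreal (u w powr q) * indicator (cball z0 r) w)"
        using ennreal_leI[OF bound, of w] sub by (auto simp: indicator_def K_def ennreal_mult)
    qed
    also have "\<dots> = ennreal K * ?I"
      using M2 by (intro nn_integral_cmult) auto
    finally have "ennreal (u z * X) \<le> ennreal (C * (K * J))"
      using C J by (simp add: K_def ennreal_mult mult_left_mono)
    then have le: "u z * X \<le> C * K * J"
      using C J by (subst (asm) ennreal_le_iff) (auto simp: K_def)
    have Mz: "M = u z powr q * (2 ^ DIM('a) * X)"
      by (simp add: M_def g_def X_def \<rho>_def power_divide)
    then have "u z powr q = (M / X) / 2 ^ DIM('a)"
      using X by (simp add: field_simps)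
    moreover have two: "(2 ^ DIM('a)) powr (1 / q) = (2::real) powr (DIM('a) / q)"
      using powr_powr[of "2::real" "real DIM('a)" "1 / q"] by (simp only: powr_realpow) simp
    ultimately have "(u z powr q) powr (1 / q) = (M / X) powr (1 / q) / (2 ^ DIM('a)) powr (1 / q)"
      using M X by (simp add: powr_divide powr_mult)
    then have "u z = (M / X) powr (1 / q) / 2 powr (DIM('a) / q)"
      using q uz two by (simp add: powr_powr)
    also have "(M / X) powr (1 / q) = K * (M / X)"
    proof -
      have e: "1 / q = (1 - q) / q + 1" using q by (simp add: field_simps)
      show ?thesis unfolding K_def e using M X by (simp add: powr_add)
    qed
    finally have "K * (M / 2 powr (DIM('a) / q)) = u z * X" using X by simp
    also have "\<dots> \<le> K * (C * J)" using le by (simp add: mult_ac)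
    finally have "K * (M / 2 powr (DIM('a) / q)) \<le> K * (C * J)" .
    moreover have "K > 0" using M X by (simp add: K_def)
    ultimately have "M / 2 powr (DIM('a) / q) \<le> C * J"
      by (simp only: mult_le_cancel_left_pos)
    then have "M \<le> C * 2 powr (DIM('a) / q) * J"
      by (simp add: field_simps)
    with gz0 have "u z0 powr q * r ^ DIM('a) \<le> C * 2 powr (DIM('a) / q) * J" by linarith
    then show ?thesis using J C by (simp add: ennreal_leI flip: ennreal_mult)
  qed
qed

lemma harmonic_powr_le_average:
  assumes q: "0 < q"
  shows "\<exists>C>0. \<forall>(f :: 'a::euclidean_space \<Rightarrow> real) S z r. harmonic_on f S \<longrightarrow> 0 < r \<longrightarrow> cball z r \<subseteq> S \<longrightarrow>
     ennreal (\<bar>f z\<bar> powr q * r ^ DIM('a)) \<le>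
       ennreal C * (\<integral>\<^sup>+w\<in>cball z r. ennreal (\<bar>f w\<bar> powr q) \<partial>lborel)"
proof -
  obtain C where C: "C > 0" and mean: "\<And>(f :: 'a \<Rightarrow> real) S z r.
      harmonic_on f S \<Longrightarrow> 0 < r \<Longrightarrow> cball z r \<subseteq> S \<Longrightarrow>
      ennreal (\<bar>f z\<bar> * r ^ DIM('a)) \<le> ennreal C * (\<integral>\<^sup>+w\<in>cball z r. ennreal \<bar>f w\<bar> \<partial>lborel)"
    using harmonic_abs_le_average[where 'a='a] by blast
  have cont: "continuous_on (cball z r) (\<lambda>w. \<bar>f w\<bar>)"
    if "harmonic_on f S" "cball z r \<subseteq> S" for f :: "'a \<Rightarrow> real" and S z r
    using harmonic_on_imp_continuous_on[OF that(1)] that(2)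
    by (intro continuous_intros) (rule continuous_on_subset)
  show ?thesis
  proof (cases "1 \<le> q")
    case True
    have "unit_ball_vol (real DIM('a)) \<noteq> 0"
      using unit_ball_vol_pos[of "real DIM('a)"] by (metis less_irrefl of_nat_0_le_iff)
    then have "2 * C * (2 * C * unit_ball_vol DIM('a)) powr (q - 1) > 0"
      using C by (intro mult_pos_pos) auto
    moreover have "ennreal (\<bar>f z\<bar> powr q * r ^ DIM('a)) \<le>
        ennreal (2 * C * (2 * C * unit_ball_vol DIM('a)) powr (q - 1)) *
        (\<integral>\<^sup>+w\<in>cball z r. ennreal (\<bar>f w\<bar> powr q) \<partial>lborel)"
      if "harmonic_on f S" "0 < r" "cball z r \<subseteq> S" for f :: "'a \<Rightarrow> real" and S z r
      by (rule powr_mean_bound_ge_1[OF True C that(2) cont[OF that(1,3)] _ mean[OF that]]) simp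
    ultimately show ?thesis by blast
  next
    case False
    then have q1: "q < 1" by simp
    have "C * 2 powr (DIM('a) / q) > 0" using C by simp
    moreover have "ennreal (\<bar>f z\<bar> powr q * r ^ DIM('a)) \<le> ennreal (C * 2 powr (DIM('a) / q)) *
        (\<integral>\<^sup>+w\<in>cball z r. ennreal (\<bar>f w\<bar> powr q) \<partial>lborel)"
      if "harmonic_on f S" "0 < r" "cball z r \<subseteq> S" for f :: "'a \<Rightarrow> real" and S z r
      by (rule powr_mean_bound_less_1[OF q q1 C that(2) cont[OF that(1,3)]])
        (use mean[OF that(1)] that(3) in auto)
    ultimately show ?thesis by blast
  qed
qed

subsection \<open>Means over the cubes of the half-space\<close>

lemma powr_comparable:
  fixes A v t a :: real
  assumes "1 \<le> A" "0 < v" "0 < t" "v \<le> A * t" "t \<le> A * v"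
  shows "v powr a \<le> A powr \<bar>a\<bar> * t powr a"
proof (cases "0 \<le> a")
  case True
  then have "v powr a \<le> (A * t) powr a" using assms by (intro powr_mono2) auto
  then show ?thesis using assms True by (simp add: powr_mult)
next
  case False
  have "v powr a \<le> (t / A) powr a"
    using assms False by (intro powr_mono2') (auto simp: divide_le_eq mult.commute)
  then show ?thesis using assms False by (simp add: powr_divide powr_minus_divide)
qed

lemma ennreal_powr_ennreal: "0 \<le> x \<Longrightarrow> ennreal_powr (ennreal x) a = ennreal (x powr a)"
  by (simp add: ennreal_powr_def)

lemma ennreal_powr_mono:
  assumes "0 < a" "x \<le> y"
  shows "ennreal_powr x a \<le> ennreal_powr y a"
  using assms
  by (auto simp: ennreal_powr_def top_unique less_top intro!: ennreal_leI powr_mono2 enn2real_mono)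

lemma ennreal_powr_cmult:
  assumes "0 < c"
  shows "ennreal_powr (ennreal c * x) a = ennreal (c powr a) * ennreal_powr x a"
proof (cases x)
  case (real r)
  then show ?thesis
    using assms by (simp add: ennreal_powr_ennreal powr_mult flip: ennreal_mult)
next
  case top
  then show ?thesis using assms by (simp add: ennreal_powr_def ennreal_mult_top)
qed

lemma borel_measurable_ennreal_powr [measurable]:
  "f \<in> borel_measurable M \<Longrightarrow> (\<lambda>x. ennreal_powr (f x) a) \<in> borel_measurable M"
  unfolding ennreal_powr_def
proof (rule measurable_If)
  assume f[measurable]: "f \<in> borel_measurable M"
  show "{x \<in> space M. f x = \<infinity>} \<in> sets M"
    using measurable_sets[OF f, of "{\<infinity>}"] by (simp add: vimage_def Int_def conj_commute)
qed measurable

lemma borel_measurable_snd [measurable]: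
  "(snd :: 'a::topological_space \<times> 'b::topological_space \<Rightarrow> 'b) \<in> borel_measurable borel"
  by (intro borel_measurable_continuous_onI continuous_intros)

lemma open_upper_half_space: "open (upper_half_space :: ((real ^ 'n) \<times> real) set)"
  unfolding upper_half_space_def by (intro open_Collect_less continuous_intros)

lemma upper_half_space_in_borel [measurable, simp]:
  "(upper_half_space :: ((real ^ 'n) \<times> real) set) \<in> sets borel"
  by (intro borel_open open_upper_half_space)

lemma cube_in_borel [measurable, simp]: "cube w r \<in> sets borel"
  by (simp add: cube_def)

lemma mem_cube: "(v :: 'a::euclidean_space) \<in> cube w r \<longleftrightarrow> (\<forall>b\<in>Basis. \<bar>(v - w) \<bullet> b\<bar> \<le> r / 2)"
  unfolding cube_def mem_box
proof (intro ball_cong refl)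
  fix b :: 'a assume "b \<in> Basis"
  then have "(w - (r / 2) *\<^sub>R One) \<bullet> b = w \<bullet> b - r / 2" "(w + (r / 2) *\<^sub>R One) \<bullet> b = w \<bullet> b + r / 2"
    by (simp_all add: inner_simps)
  then show "((w - (r / 2) *\<^sub>R One) \<bullet> b \<le> v \<bullet> b \<and> v \<bullet> b \<le> (w + (r / 2) *\<^sub>R One) \<bullet> b)
      = (\<bar>(v - w) \<bullet> b\<bar> \<le> r / 2)"
    by (smt (verit) inner_diff_left)
qed

lemma abs_snd_diff_le_dist: "\<bar>snd v - snd w\<bar> \<le> dist v (w :: (real ^ 'n) \<times> real)"
  using dist_snd_le[of v w] by (simp add: dist_real_def)

lemma cball_subset_upper_half_space: "r < snd z \<Longrightarrow> cball z r \<subseteq> upper_half_space"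
proof
  fix w assume "r < snd z" "w \<in> cball z r"
  then show "w \<in> upper_half_space"
    using abs_snd_diff_le_dist[of z w] by (simp add: upper_half_space_def)
qed

text \<open>With t the height of \<open>z\<close>, a point of the ball is within t / 4 of
  \<open>w\<close>, while the half side of the cube at \<open>w\<close> is at least 7 t / 16. The
  fraction 1/8 leaves room for both displacements.\<close>

lemma cball_subset_Q_cube:
  assumes "0 < snd z" "dist w z \<le> snd z / 8"
  shows "cball z (snd z / 8) \<subseteq> Q_cube w"
proof
  fix v assume v: "v \<in> cball z (snd z / 8)"
  have "dist v w \<le> snd z / 4"
    using v assms dist_triangle[of v w z] by (simp add: dist_commute)
  moreover have "\<bar>(v - w) \<bullet> b\<bar> \<le> dist v w" if "b \<in> Basis" for b
    using Basis_le_norm[OF that, of "v - w"] by (simp add: dist_norm)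
  moreover have "snd z / 4 \<le> snd w / 2"
    using abs_snd_diff_le_dist[of w z] assms by linarith
  ultimately show "v \<in> Q_cube w"
    by (fastforce simp: mem_cube)
qed

text \<open>Reduces the weighted measure to Lebesgue measure on the whole space. The indicator of
  the half-space stays, since \<open>f\<close> is controlled, and thus known to be measurable, only
  there.\<close>

lemma nn_integral_weighted_measure:
  fixes f :: "(real ^ 'n) \<times> real \<Rightarrow> real"
  assumes f: "continuous_on upper_half_space f" and s: "0 < s" and [measurable]: "Q \<in> sets borel"
  shows "(\<integral>\<^sup>+z\<in>Q. ennreal (\<bar>f z\<bar> powr s) \<partial>weighted_measure a) =
    (\<integral>\<^sup>+z\<in>Q. ennreal (snd z powr a * \<bar>f z\<bar> powr s) * indicator upper_half_space z \<partial>lborel)"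
proof -
  let ?H = "upper_half_space :: ((real ^ 'n) \<times> real) set"
  let ?R = "restrict_space lborel ?H"
  have "f \<in> borel_measurable (restrict_space borel ?H)"
    by (rule borel_measurable_continuous_on_restrict[OF f])
  then have [measurable]: "f \<in> borel_measurable ?R"
    by (simp cong: measurable_cong_sets restrict_space_sets_cong)
  have [measurable]: "snd \<in> borel_measurable ?R" "(\<lambda>z. indicator Q z :: ennreal) \<in> borel_measurable ?R"
    by (auto intro!: measurable_restrict_space1)
  have "(\<integral>\<^sup>+z\<in>Q. ennreal (\<bar>f z\<bar> powr s) \<partial>weighted_measure a) =
      (\<integral>\<^sup>+z. ennreal (snd z powr a) * (ennreal (\<bar>f z\<bar> powr s) * indicator Q z) \<partial>?R)"
    unfolding weighted_measure_def by (subst nn_integral_density) auto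
  also have "\<dots> = (\<integral>\<^sup>+z. ennreal (snd z powr a) * (ennreal (\<bar>f z\<bar> powr s) * indicator Q z) *
      indicator ?H z \<partial>lborel)"
    by (subst nn_integral_restrict_space) auto
  also have "\<dots> = (\<integral>\<^sup>+z\<in>Q. ennreal (snd z powr a * \<bar>f z\<bar> powr s) * indicator ?H z \<partial>lborel)"
    by (intro nn_integral_cong) (simp add: ennreal_mult mult_ac)
  finally show ?thesis .
qed

text \<open>The domain of integration moves with \<open>w\<close>. The relation "z lies in the cube
  at w" is closed, hence jointly measurable, and measurability of parameter integrals
  applies.\<close>

lemma borel_measurable_weighted_measure_Q_cube:
  fixes f :: "(real ^ 'n) \<times> real \<Rightarrow> real"
  assumes f: "continuous_on upper_half_space f" and s: "0 < s"
  shows "(\<lambda>w. \<integral>\<^sup>+z\<in>Q_cube w. ennreal (\<bar>f z\<bar> powr s) \<partial>weighted_measure a) \<in> borel_measurable borel"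
proof -
  let ?H = "upper_half_space :: ((real ^ 'n) \<times> real) set"
  define g where "g z = ennreal (snd z powr a * \<bar>f z\<bar> powr s) * indicator ?H z" for z
  have "(\<lambda>z. indicator ?H z *\<^sub>R f z) \<in> borel_measurable borel"
    by (intro borel_measurable_continuous_on_indicator f) auto
  then have "(\<lambda>z. ennreal (snd z powr a * \<bar>indicator ?H z *\<^sub>R f z\<bar> powr s)) \<in> borel_measurable borel"
    by measurable
  moreover have "(\<lambda>z. ennreal (snd z powr a * \<bar>indicator ?H z *\<^sub>R f z\<bar> powr s)) = g"
    by (auto simp: g_def indicator_def fun_eq_iff)
  ultimately have g[measurable]: "g \<in> borel_measurable borel" by (simp only:)
  define K where "K = {q :: ((real ^ 'n) \<times> real) \<times> ((real ^ 'n) \<times> real). snd q \<in> Q_cube (fst q)}"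
  have "K = (\<Inter>b\<in>Basis. {q. \<bar>(snd q - fst q) \<bullet> b\<bar> \<le> snd (fst q) / 2})"
    by (auto simp: K_def mem_cube)
  also have "closed \<dots>"
    by (intro closed_INT ballI closed_Collect_le continuous_intros) auto
  finally have "K \<in> sets borel" by (rule borel_closed)
  then have [measurable]: "K \<in> sets (borel \<Otimes>\<^sub>M borel)" by (subst borel_prod)
  have "(\<lambda>w. \<integral>\<^sup>+z. g z * indicator K (w, z) \<partial>lborel) \<in> borel_measurable borel"
    by measurable
  moreover have "(\<lambda>w. \<integral>\<^sup>+z. g z * indicator K (w, z) \<partial>lborel) =
     (\<lambda>w. \<integral>\<^sup>+z\<in>Q_cube w. ennreal (\<bar>f z\<bar> powr s) \<partial>weighted_measure a)"
    unfolding nn_integral_weighted_measure[OF f s cube_in_borel]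
    by (auto simp: g_def K_def indicator_def fun_eq_iff intro!: nn_integral_cong)
  ultimately show ?thesis by (simp only:)
qed

text \<open>The integrand of the right-hand side in the inequality (1). It is not normalized by the
  mass of the cube; this mass is what produces the exponent q (n + 1 + a) / s below.\<close>

definition Q_mean ::
    "real \<Rightarrow> real \<Rightarrow> real \<Rightarrow> ((real ^ 'n) \<times> real \<Rightarrow> real) \<Rightarrow> (real ^ 'n) \<times> real \<Rightarrow> ennreal" where
  "Q_mean a s q f w =
     ennreal_powr (\<integral>\<^sup>+z\<in>Q_cube w. ennreal (\<bar>f z\<bar> powr s) \<partial>weighted_measure a) (q / s)"

lemma borel_measurable_Q_mean:
  assumes "continuous_on upper_half_space f" "0 < s"
  shows "Q_mean a s q f \<in> borel_measurable borel"
  unfolding Q_mean_def[abs_def]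
  by (intro borel_measurable_ennreal_powr borel_measurable_weighted_measure_Q_cube assms)

text \<open>The ball of radius t / 8 around \<open>z\<close> lies in the cube at every
  \<open>w\<close> near \<open>z\<close>, and on it heights stay within a factor 2 of t. So the
  Lebesgue mean over the ball is controlled by the weighted integral over the cube.\<close>

lemma harmonic_powr_le_Q_integral:
  assumes s: "0 < s"
  shows "\<exists>C>0. \<forall>(f :: (real ^ 'n) \<times> real \<Rightarrow> real) z w. harmonic_on f upper_half_space \<longrightarrow> 0 < snd z \<longrightarrow>
     dist w z \<le> snd z / 8 \<longrightarrow>
     ennreal (\<bar>f z\<bar> powr s * snd z powr (real CARD('n) + 1 + a)) \<le>
       ennreal C * (\<integral>\<^sup>+z\<in>Q_cube w. ennreal (\<bar>f z\<bar> powr s) \<partial>weighted_measure a)"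
proof -
  let ?H = "upper_half_space :: ((real ^ 'n) \<times> real) set"
  let ?d = "CARD('n) + 1"
  obtain C where C: "C > 0" and mean: "\<And>(f :: (real ^ 'n) \<times> real \<Rightarrow> real) S z r.
      harmonic_on f S \<Longrightarrow> 0 < r \<Longrightarrow> cball z r \<subseteq> S \<Longrightarrow>
      ennreal (\<bar>f z\<bar> powr s * r ^ ?d) \<le>
        ennreal C * (\<integral>\<^sup>+w\<in>cball z r. ennreal (\<bar>f w\<bar> powr s) \<partial>lborel)"
    using harmonic_powr_le_average[OF s, where 'a="(real ^ 'n) \<times> real"] by auto
  \<comment> \<open>The power of 8 comes from the radius t / 8, the power of 2 from replacing the
    weight by its value at height t.\<close>
  define C' where "C' = 8 ^ ?d * C * 2 powr \<bar>a\<bar>"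
  have "C' > 0" using C by (simp add: C'_def)
  moreover have "ennreal (\<bar>f z\<bar> powr s * snd z powr (real CARD('n) + 1 + a)) \<le>
       ennreal C' * (\<integral>\<^sup>+z\<in>Q_cube w. ennreal (\<bar>f z\<bar> powr s) \<partial>weighted_measure a)"
    if f: "harmonic_on f ?H" and z: "0 < snd z" and w: "dist w z \<le> snd z / 8" for f z w
  proof -
    define t where "t = snd z"
    have t: "t > 0" using z by (simp add: t_def)
    let ?B = "cball z (t / 8)"
    have BH: "?B \<subseteq> ?H" using z by (intro cball_subset_upper_half_space) (simp add: t_def)
    have BQ: "?B \<subseteq> Q_cube w" using cball_subset_Q_cube[OF z w] by (simp add: t_def)
    have fc: "continuous_on ?H f" by (rule harmonic_on_imp_continuous_on[OF f])
    have fB: "continuous_on ?B (\<lambda>w. \<bar>f w\<bar>)"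
      by (intro continuous_intros continuous_on_subset[OF fc BH])
    have "t powr (real CARD('n) + 1 + a) = 8 ^ ?d * (t powr a * (t / 8) ^ ?d)"
      using t by (simp add: powr_add powr_realpow power_divide add.commute)
    then have "ennreal (\<bar>f z\<bar> powr s * t powr (real CARD('n) + 1 + a)) =
      ennreal (8 ^ ?d) * (ennreal (t powr a) * ennreal (\<bar>f z\<bar> powr s * (t / 8) ^ ?d))"
      using t by (simp add: mult_ac flip: ennreal_mult)
    also have "\<dots> \<le> ennreal (8 ^ ?d) * (ennreal (t powr a) *
        (ennreal C * (\<integral>\<^sup>+v\<in>?B. ennreal (\<bar>f v\<bar> powr s) \<partial>lborel)))"
      using t BH by (intro mult_left_mono mean[OF f]) auto
    also have "\<dots> = ennreal (8 ^ ?d * C) * (\<integral>\<^sup>+v. ennreal (t powr a) * (ennreal (\<bar>f v\<bar> powr s) * indicator ?B v) \<partial>lborel)"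
      using s C by (subst nn_integral_cmult)
        (auto intro!: borel_measurable_powr_indicator fB simp: ennreal_mult mult_ac)
    also have "\<dots> \<le> ennreal (8 ^ ?d * C) * (\<integral>\<^sup>+v. ennreal (2 powr \<bar>a\<bar>) *
        (ennreal (snd v powr a * \<bar>f v\<bar> powr s) * indicator ?B v) \<partial>lborel)"
    proof (intro mult_left_mono nn_integral_mono)
      fix v
      have "t powr a \<le> 2 powr \<bar>a\<bar> * snd v powr a" if "v \<in> ?B"
        using that abs_snd_diff_le_dist[of z v] t
        by (intro powr_comparable) (auto simp: t_def)
      then have "v \<in> ?B \<Longrightarrow> ennreal (t powr a * \<bar>f v\<bar> powr s) \<le> ennreal ((2 powr \<bar>a\<bar> * snd v powr a) * \<bar>f v\<bar> powr s)"
        by (intro ennreal_leI mult_right_mono) auto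
      then show "ennreal (t powr a) * (ennreal (\<bar>f v\<bar> powr s) * indicator ?B v) \<le>
         ennreal (2 powr \<bar>a\<bar>) * (ennreal (snd v powr a * \<bar>f v\<bar> powr s) * indicator ?B v)"
        by (auto simp: indicator_def ennreal_mult mult_ac)
    qed auto
    also have "\<dots> = ennreal C' * (\<integral>\<^sup>+v. ennreal (snd v powr a * \<bar>f v\<bar> powr s) * indicator ?B v \<partial>lborel)"
    proof (subst nn_integral_cmult)
      have "(\<lambda>v. ennreal (snd v powr a) * (ennreal (\<bar>f v\<bar> powr s) * indicator ?B v)) \<in> borel_measurable borel"
        by (intro borel_measurable_times_ennreal borel_measurable_powr_indicator fB s) auto
      then show "(\<lambda>v. ennreal (snd v powr a * \<bar>f v\<bar> powr s) * indicator ?B v) \<in> borel_measurable lborel"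
        by (simp add: ennreal_mult mult.assoc)
    qed (use C in \<open>simp add: C'_def ennreal_mult mult_ac\<close>)
    also have "\<dots> \<le> ennreal C' * (\<integral>\<^sup>+v\<in>Q_cube w. ennreal (snd v powr a * \<bar>f v\<bar> powr s) * indicator ?H v \<partial>lborel)"
      using BH BQ by (intro mult_left_mono nn_integral_mono) (auto simp: indicator_def)
    also have "\<dots> = ennreal C' * (\<integral>\<^sup>+z\<in>Q_cube w. ennreal (\<bar>f z\<bar> powr s) \<partial>weighted_measure a)"
      by (subst nn_integral_weighted_measure[OF fc s]) auto
    finally show ?thesis by (simp add: t_def)
  qed
  ultimately show ?thesis by blast
qed

text \<open>The preceding bound, raised to the power q / s, has a left-hand side free of
  \<open>w\<close>. Integrating over the ball of admissible \<open>w\<close> multiplies it by a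
  volume of order t^(n+1), the additional term in the exponent.\<close>

lemma harmonic_powr_le_integral_Q_mean:
  assumes s: "0 < s" and q: "0 < q"
  shows "\<exists>C>0. \<forall>(f :: (real ^ 'n) \<times> real \<Rightarrow> real) z. harmonic_on f upper_half_space \<longrightarrow> 0 < snd z \<longrightarrow>
     ennreal (\<bar>f z\<bar> powr q * snd z powr (real CARD('n) + 1 + q * (real CARD('n) + 1 + a) / s)) \<le>
       ennreal C * (\<integral>\<^sup>+w\<in>cball z (snd z / 8). Q_mean a s q f w \<partial>lborel)"
proof -
  let ?H = "upper_half_space :: ((real ^ 'n) \<times> real) set"
  define d where "d = CARD('n) + 1"
  obtain C where C: "C > 0" and mean: "\<And>(f :: (real ^ 'n) \<times> real \<Rightarrow> real) z w.
      harmonic_on f ?H \<Longrightarrow> 0 < snd z \<Longrightarrow> dist w z \<le> snd z / 8 \<Longrightarrow>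
     ennreal (\<bar>f z\<bar> powr s * snd z powr (real CARD('n) + 1 + a)) \<le>
       ennreal C * (\<integral>\<^sup>+z\<in>Q_cube w. ennreal (\<bar>f z\<bar> powr s) \<partial>weighted_measure a)"
    using harmonic_powr_le_Q_integral[OF s, where 'n='n and a=a] by blast
  define V where "V = unit_ball_vol (real d)"
  have V: "V > 0" by (simp add: V_def)
  define C' where "C' = 8 ^ d / V * C powr (q / s)"
  have "C' > 0" using C V by (simp add: C'_def)
  moreover have "ennreal (\<bar>f z\<bar> powr q * snd z powr (real CARD('n) + 1 + q * (real CARD('n) + 1 + a) / s)) \<le>
       ennreal C' * (\<integral>\<^sup>+w\<in>cball z (snd z / 8). Q_mean a s q f w \<partial>lborel)"
    if f: "harmonic_on f ?H" and z: "0 < snd z" for f z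
  proof -
    define t where "t = snd z"
    have t: "t > 0" using z by (simp add: t_def)
    let ?B = "cball z (t / 8)"
    have [measurable]: "?B \<in> sets borel" by (rule borel_closed[OF closed_cball])
    define e where "e = q * (real CARD('n) + 1 + a) / s"
    have fc: "continuous_on ?H f" by (rule harmonic_on_imp_continuous_on[OF f])
    have J[measurable]: "Q_mean a s q f \<in> borel_measurable borel"
      by (rule borel_measurable_Q_mean[OF fc s])
    have pt: "ennreal (\<bar>f z\<bar> powr q * t powr e) \<le> ennreal (C powr (q / s)) * Q_mean a s q f w"
      if w: "w \<in> ?B" for w
    proof -
      have "ennreal_powr (ennreal (\<bar>f z\<bar> powr s * t powr (real CARD('n) + 1 + a))) (q / s) \<le>
        ennreal_powr (ennreal C * (\<integral>\<^sup>+z\<in>Q_cube w. ennreal (\<bar>f z\<bar> powr s) \<partial>weighted_measure a)) (q / s)"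
        using w s q mean[OF f z, of w] by (intro ennreal_powr_mono) (auto simp: t_def dist_commute)
      then show ?thesis
        using s by (simp add: ennreal_powr_ennreal ennreal_powr_cmult[OF C] Q_mean_def powr_mult powr_powr e_def
            mult.commute)
    qed
    have "ennreal (\<bar>f z\<bar> powr q * t powr e) * emeasure lborel ?B =
      (\<integral>\<^sup>+w\<in>?B. ennreal (\<bar>f z\<bar> powr q * t powr e) \<partial>lborel)"
      by (simp add: nn_integral_cmult_indicator)
    also have "\<dots> \<le> (\<integral>\<^sup>+w. ennreal (C powr (q / s)) * (Q_mean a s q f w * indicator ?B w) \<partial>lborel)"
      using pt by (intro nn_integral_mono) (auto simp: indicator_def)
    also have "\<dots> = ennreal (C powr (q / s)) * (\<integral>\<^sup>+w\<in>?B. Q_mean a s q f w \<partial>lborel)"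
      by (intro nn_integral_cmult) measurable
    finally have le: "ennreal (\<bar>f z\<bar> powr q * t powr e) * emeasure lborel ?B \<le>
      ennreal (C powr (q / s)) * (\<integral>\<^sup>+w\<in>?B. Q_mean a s q f w \<partial>lborel)" .
    have "emeasure lborel ?B = ennreal (V * (t / 8) ^ d)"
      using t by (simp add: emeasure_cball V_def d_def add.commute)
    moreover have "t powr (real CARD('n) + 1 + e) = 8 ^ d / V * (t powr e * (V * (t / 8) ^ d))"
      using t V by (simp add: powr_add d_def powr_realpow power_divide)
    ultimately have "ennreal (\<bar>f z\<bar> powr q * t powr (real CARD('n) + 1 + e)) =
      ennreal (8 ^ d / V) * (ennreal (\<bar>f z\<bar> powr q * t powr e) * emeasure lborel ?B)"
      using t V by (simp add: mult_ac flip: ennreal_mult)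
    also have "\<dots> \<le> ennreal (8 ^ d / V) * (ennreal (C powr (q / s)) * (\<integral>\<^sup>+w\<in>?B. Q_mean a s q f w \<partial>lborel))"
      by (intro mult_left_mono le) auto
    also have "\<dots> = ennreal C' * (\<integral>\<^sup>+w\<in>?B. Q_mean a s q f w \<partial>lborel)"
    proof -
      have "ennreal C' = ennreal (8 ^ d / V) * ennreal (C powr (q / s))"
        unfolding C'_def using V by (intro ennreal_mult) auto
      then show ?thesis by (simp add: mult.assoc)
    qed
    finally show ?thesis by (simp add: t_def e_def)
  qed
  ultimately show ?thesis by blast
qed

subsection \<open>Geometry of Whitney cubes\<close>

lemma center_in_cube: "0 \<le> l \<Longrightarrow> z \<in> cube z l"
  by (simp add: mem_cube)

lemma dist_le_of_mem_cube:
  fixes z :: "'a::euclidean_space"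
  assumes "v \<in> cube z l" "w \<in> cube z l"
  shows "dist v w \<le> real DIM('a) * l"
proof -
  have "\<bar>(v - w) \<bullet> b\<bar> \<le> l" if "b \<in> Basis" for b
  proof -
    have "\<bar>(v - z) \<bullet> b\<bar> \<le> l / 2" "\<bar>(w - z) \<bullet> b\<bar> \<le> l / 2"
      using assms that unfolding mem_cube by blast+
    then show ?thesis unfolding inner_diff_left by linarith
  qed
  then have "(\<Sum>b\<in>Basis. \<bar>(v - w) \<bullet> b\<bar>) \<le> (\<Sum>b\<in>(Basis :: 'a set). l)" by (rule sum_mono)
  then show ?thesis using norm_le_l1[of "v - w"] by (simp add: dist_norm)
qed

lemma diameter_cube_bounds:
  fixes z :: "'a::euclidean_space"
  assumes l: "0 < l"
  shows "l \<le> diameter (cube z l)" "diameter (cube z l) \<le> real DIM('a) * l"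
proof -
  obtain b :: 'a where b: "b \<in> Basis" using nonempty_Basis by blast
  have "z + (l / 2) *\<^sub>R b \<in> cube z l" "z - (l / 2) *\<^sub>R b \<in> cube z l"
    using l b by (auto simp: mem_cube inner_simps inner_Basis)
  then have "dist (z + (l / 2) *\<^sub>R b) (z - (l / 2) *\<^sub>R b) \<le> diameter (cube z l)"
    by (intro diameter_bounded_bound) (simp_all add: cube_def)
  moreover have "dist (z + (l / 2) *\<^sub>R b) (z - (l / 2) *\<^sub>R b) = l"
    using l b by (simp add: dist_norm flip: scaleR_left.add)
  ultimately show "l \<le> diameter (cube z l)" by simp
  show "diameter (cube z l) \<le> real DIM('a) * l"
    using dist_le_of_mem_cube[of _ z l] center_in_cube[of l z] l
    by (intro diameter_le) (auto simp: dist_norm)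
qed

lemma emeasure_interior_cube:
  fixes z :: "'a::euclidean_space"
  assumes "0 < l"
  shows "emeasure lborel (interior (cube z l)) = ennreal (l ^ DIM('a))"
proof -
  have "((z + (l / 2) *\<^sub>R One) - (z - (l / 2) *\<^sub>R One)) \<bullet> b = l" if "b \<in> Basis" for b
    using that by (simp add: inner_simps)
  then show ?thesis
    using assms unfolding cube_def interior_cbox
    by (subst emeasure_lborel_box) (auto simp: inner_simps)
qed

lemma frontier_upper_half_space:
  "frontier (upper_half_space :: ((real ^ 'n) \<times> real) set) = {z. snd z = 0}"
proof -
  have "frontier {z. (0 :: real ^ 'n, 1 :: real) \<bullet> z > 0} = {z. (0, 1) \<bullet> z = 0}"
    by (rule frontier_halfspace_gt) (simp add: zero_prod_def)
  then show ?thesis by (simp add: upper_half_space_def inner_prod_def)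
qed

text \<open>The diameter is comparable to the side, and the distance to the boundary differs from
  the height of any point of the cube by at most the diameter. One constant thus serves all points
  of all cubes, centers included.\<close>

lemma whitney_decomposition_comparable:
  fixes \<zeta> :: "nat \<Rightarrow> (real ^ 'n) \<times> real"
  assumes W: "whitney_decomposition upper_half_space \<zeta> l"
  shows "\<exists>A\<ge>1. \<forall>k. \<forall>z\<in>cube (\<zeta> k) (l k). l k \<le> A * snd z \<and> snd z \<le> A * l k"
proof -
  let ?F = "frontier (upper_half_space :: ((real ^ 'n) \<times> real) set)"
  let ?d = "real (CARD('n) + 1)"
  from W have l: "\<And>k. l k > 0" and un: "(\<Union>k. cube (\<zeta> k) (l k)) = upper_half_space"
    unfolding whitney_decomposition_def by auto
  from W obtain c C where c: "c > 0" and C: "C > 0"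
    and "\<forall>k. c * setdist (cube (\<zeta> k) (l k)) ?F \<le> diameter (cube (\<zeta> k) (l k)) \<and>
      diameter (cube (\<zeta> k) (l k)) \<le> C * setdist (cube (\<zeta> k) (l k)) ?F"
    unfolding whitney_decomposition_def by (elim conjE exE) (rule that)
  then have le: "c * setdist (cube (\<zeta> k) (l k)) ?F \<le> diameter (cube (\<zeta> k) (l k))"
    "diameter (cube (\<zeta> k) (l k)) \<le> C * setdist (cube (\<zeta> k) (l k)) ?F" for k
    by simp_all
  \<comment> \<open>\<open>C\<close> bounds the side by the height, ?d + ?d / c bounds the height by
    the side, and the summand 1 makes \<open>A\<close> at least 1.\<close>
  define A where "A = 1 + C + (?d + ?d / c)"
  have "A \<ge> 1" using c C by (simp add: A_def)
  moreover have "l k \<le> A * snd z \<and> snd z \<le> A * l k" if z: "z \<in> cube (\<zeta> k) (l k)" for k z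
  proof
    let ?Q = "cube (\<zeta> k) (l k)"
    have z0: "snd z > 0" using un z by (auto simp: upper_half_space_def)
    have "setdist ?Q ?F \<le> dist z (fst z, 0)"
      by (rule setdist_le_dist) (use z in \<open>auto simp: frontier_upper_half_space\<close>)
    also have "\<dots> = snd z" using z0 by (simp add: dist_prod_def dist_real_def)
    finally have "C * setdist ?Q ?F \<le> C * snd z" using C by simp
    then have "l k \<le> C * snd z"
      using le(2)[of k] diameter_cube_bounds(1)[OF l[of k], of "\<zeta> k"] by linarith
    also have "\<dots> \<le> A * snd z" using z0 c by (intro mult_right_mono) (auto simp: A_def)
    finally show "l k \<le> A * snd z" .
    have "snd z - ?d * l k \<le> setdist ?Q ?F"
    proof (rule le_setdistI)
      fix v y assume v: "v \<in> ?Q" and "y \<in> ?F"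
      then have "snd y = 0" by (simp add: frontier_upper_half_space)
      then show "snd z - ?d * l k \<le> dist v y"
        using dist_le_of_mem_cube[OF z v] abs_snd_diff_le_dist[of v y] abs_snd_diff_le_dist[of z v]
        by (simp add: add.commute)
    next
      have "(0, 0) \<in> ?F" by (simp add: frontier_upper_half_space)
      then show "?F \<noteq> {}" by blast
    qed (use z in blast)
    then have "c * (snd z - ?d * l k) \<le> c * setdist ?Q ?F" using c by simp
    also have "\<dots> \<le> ?d * l k"
      using le(1)[of k] diameter_cube_bounds(2)[OF l[of k], of "\<zeta> k"] by (simp add: add.commute)
    finally have "c * (snd z - ?d * l k) \<le> ?d * l k" .
    then have "snd z \<le> (?d + ?d / c) * l k" using c by (simp add: field_simps)
    also have "\<dots> \<le> A * l k" using l[of k] C by (intro mult_right_mono) (auto simp: A_def)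
    finally show "snd z \<le> A * l k" .
  qed
  ultimately show ?thesis by blast
qed

text \<open>Since \<open>B\<close> may exceed 1, the ball alone can reach the boundary, where
  infinitely many such balls may overlap. The lower bound on the height of \<open>w\<close> restores
  bounded overlap.\<close>

definition whitney_neighbourhood :: "real \<Rightarrow> (real ^ 'n) \<times> real \<Rightarrow> ((real ^ 'n) \<times> real) set" where
  "whitney_neighbourhood B z = cball z (B * snd z) \<inter> {w. snd z \<le> B * snd w}"

lemma whitney_neighbourhood_in_borel [measurable, simp]:
  "whitney_neighbourhood B z \<in> sets borel"
  unfolding whitney_neighbourhood_def
  by (intro borel_closed closed_Int closed_cball closed_Collect_le continuous_intros)

text \<open>Volume count: all cubes whose neighbourhoods contain \<open>w\<close> have sides bounded
  below by a multiple of the height s of \<open>w\<close>, lie in a ball of radius a multiple of s,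
  and have disjoint interiors. The ratio of volumes does not depend on s.\<close>

lemma whitney_overlap:
  fixes \<zeta> :: "nat \<Rightarrow> (real ^ 'n) \<times> real"
  assumes W: "whitney_decomposition upper_half_space \<zeta> l" and B: "0 < B"
  shows "\<exists>N>0. \<forall>w. (\<Sum>k. indicator (whitney_neighbourhood B (\<zeta> k)) w) \<le> ennreal N"
proof -
  let ?d = "CARD('n) + 1"
  from W have l: "\<And>k. l k > 0"
    and disj: "\<And>j k. j \<noteq> k \<Longrightarrow> interior (cube (\<zeta> j) (l j)) \<inter> interior (cube (\<zeta> k) (l k)) = {}"
    and un: "(\<Union>k. cube (\<zeta> k) (l k)) = upper_half_space"
    unfolding whitney_decomposition_def by auto
  have \<zeta>: "\<zeta> k \<in> cube (\<zeta> k) (l k)" for k using l[of k] by (intro center_in_cube) simp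
  then have \<eta>: "snd (\<zeta> k) > 0" for k using un by (auto simp: upper_half_space_def)
  obtain A where A: "A \<ge> 1" "\<And>k. l k \<le> A * snd (\<zeta> k)" "\<And>k. snd (\<zeta> k) \<le> A * l k"
    using whitney_decomposition_comparable[OF W] \<zeta> by blast
  define R where "R = (real ?d * A + B) * B"
  have R: "R > 0" using A B by (simp add: R_def add_pos_pos)
  define N where "N = unit_ball_vol ?d * (R * (A * (1 + B))) ^ ?d"
  have "N > 0" using R A B by (simp add: N_def)
  moreover have "(\<Sum>k. indicator (whitney_neighbourhood B (\<zeta> k)) w) \<le> ennreal N" for w
    \<comment> \<open>Partial sums keep the index set finite, so that its cardinality is available
      before a bound is known.\<close>
    unfolding suminf_eq_SUP
  proof (rule SUP_least)
    fix n
    define K where "K = {k \<in> {..<n}. w \<in> whitney_neighbourhood B (\<zeta> k)}"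
    have K: "finite K" by (simp add: K_def)
    have "real (card K) \<le> N"
    proof (cases "K = {}")
      case False
      define s where "s = snd w"
      have mem: "dist (\<zeta> k) w \<le> B * snd (\<zeta> k)" "snd (\<zeta> k) \<le> B * s" if "k \<in> K" for k
        using that by (auto simp: K_def whitney_neighbourhood_def s_def)
      from False obtain k0 where "k0 \<in> K" by blast
      then have "0 < B * s" using mem(2)[of k0] \<eta>[of k0] by linarith
      then have s: "s > 0" using B by (simp add: zero_less_mult_iff)
      have sub: "interior (cube (\<zeta> k) (l k)) \<subseteq> cball w (R * s)" if k: "k \<in> K" for k
      proof
        fix v assume "v \<in> interior (cube (\<zeta> k) (l k))"
        then have "v \<in> cube (\<zeta> k) (l k)" using interior_subset by blast
        then have "dist v (\<zeta> k) \<le> real ?d * l k"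
          using dist_le_of_mem_cube[OF _ \<zeta>] by (fastforce simp: add.commute)
        then have "dist w v \<le> real ?d * l k + B * snd (\<zeta> k)"
          using dist_triangle[of w v "\<zeta> k"] mem(1)[OF k] by (simp add: dist_commute)
        also have "\<dots> \<le> real ?d * (A * snd (\<zeta> k)) + B * snd (\<zeta> k)"
          using A B \<eta>[of k] by (intro add_mono mult_left_mono) auto
        also have "\<dots> = (real ?d * A + B) * snd (\<zeta> k)" by (simp add: algebra_simps)
        also have "\<dots> \<le> (real ?d * A + B) * (B * s)"
          using A B mem(2)[OF k] by (intro mult_left_mono) auto
        finally show "v \<in> cball w (R * s)" by (simp add: R_def mult.assoc)
      qed
      have lk: "s / (A * (1 + B)) \<le> l k" if k: "k \<in> K" for k
      proof -
        have "s \<le> snd (\<zeta> k) + B * snd (\<zeta> k)"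
          using abs_snd_diff_le_dist[of "\<zeta> k" w] mem(1)[OF k] by (simp add: s_def)
        also have "\<dots> = (1 + B) * snd (\<zeta> k)" by (simp add: algebra_simps)
        also have "\<dots> \<le> (1 + B) * (A * l k)" using B A by (intro mult_left_mono) auto
        finally show ?thesis using A B by (simp add: divide_le_eq mult_ac)
      qed
      have "(\<Sum>k\<in>K. ennreal ((s / (A * (1 + B))) ^ ?d)) \<le> (\<Sum>k\<in>K. emeasure lborel (interior (cube (\<zeta> k) (l k))))"
      proof (rule sum_mono)
        fix k assume k: "k \<in> K"
        have "(s / (A * (1 + B))) ^ ?d \<le> l k ^ ?d"
          using s A B by (intro power_mono lk[OF k]) auto
        then show "ennreal ((s / (A * (1 + B))) ^ ?d) \<le> emeasure lborel (interior (cube (\<zeta> k) (l k)))"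
          by (simp add: emeasure_interior_cube[OF l] ennreal_leI)
      qed
      also have "\<dots> = emeasure lborel (\<Union>k\<in>K. interior (cube (\<zeta> k) (l k)))"
        using K disj by (intro sum_emeasure) (auto simp: disjoint_family_on_def)
      also have "\<dots> \<le> emeasure lborel (cball w (R * s))"
        using sub by (intro emeasure_mono) auto
      also have "\<dots> = ennreal (unit_ball_vol ?d * (R * s) ^ ?d)"
        using R s by (simp add: emeasure_cball add.commute)
      finally have "real (card K) * (s / (A * (1 + B))) ^ ?d \<le> unit_ball_vol ?d * (R * s) ^ ?d"
        using s A B R by (simp add: ennreal_of_nat_eq_real_of_nat flip: ennreal_mult)
      then have "real (card K) * s ^ ?d \<le> N * s ^ ?d"
        using A B by (simp add: N_def power_mult_distrib power_divide divide_le_eq mult_ac)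
      then show ?thesis using s by simp
    qed (use \<open>N > 0\<close> in simp)
    moreover have "(\<Sum>k<n. indicator (whitney_neighbourhood B (\<zeta> k)) w) = ennreal (real (card K))"
      by (simp add: K_def indicator_def sum.If_cases ennreal_of_nat_eq_real_of_nat Int_def flip: sum.inter_filter)
    ultimately show "(\<Sum>k<n. indicator (whitney_neighbourhood B (\<zeta> k)) w) \<le> ennreal N"
      by (simp add: ennreal_leI)
  qed
  ultimately show ?thesis by blast
qed

subsection \<open>Sufficiency of the growth condition\<close>

lemma le_suminf_ennreal: "(a :: nat \<Rightarrow> ennreal) k \<le> (\<Sum>k. a k)"
  using sum_le_suminf[of a "{k}"] by (simp add: summableI)

lemma suminf_mult_le_ennreal:
  fixes a b :: "nat \<Rightarrow> ennreal"
  shows "(\<Sum>k. a k * b k) \<le> (\<Sum>k. a k) * (\<Sum>k. b k)"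
proof -
  have "(\<Sum>k. a k * b k) \<le> (\<Sum>k. (\<Sum>k. a k) * b k)"
    by (intro suminf_le mult_right_mono le_suminf_ennreal summableI) auto
  then show ?thesis by simp
qed

text \<open>Expanding the product of the sums yields the diagonal terms and further nonnegative
  ones. For empty \<open>I\<close> the left side would be an infinite sum of ones; this is where at
  least one function is needed.\<close>

lemma suminf_prod_le_ennreal:
  fixes a :: "'i \<Rightarrow> nat \<Rightarrow> ennreal"
  assumes "finite I" "I \<noteq> {}"
  shows "(\<Sum>k. \<Prod>i\<in>I. a i k) \<le> (\<Prod>i\<in>I. \<Sum>k. a i k)"
  using assms
proof (induction I rule: finite_ne_induct)
  case (insert i I)
  have "(\<Sum>k. \<Prod>i\<in>insert i I. a i k) \<le> (\<Sum>k. a i k) * (\<Sum>k. \<Prod>i\<in>I. a i k)"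
    using insert suminf_mult_le_ennreal[of "a i"] by simp
  also have "\<dots> \<le> (\<Sum>k. a i k) * (\<Prod>i\<in>I. \<Sum>k. a i k)"
    by (intro mult_left_mono insert) auto
  finally show ?case using insert by simp
qed simp

lemma suminf_whitney_integral_le:
  fixes \<zeta> :: "nat \<Rightarrow> (real ^ 'n) \<times> real"
  assumes W: "whitney_decomposition upper_half_space \<zeta> l" and B: "0 < B"
  shows "\<exists>N>0. \<forall>J \<in> borel_measurable borel.
    (\<Sum>k. \<integral>\<^sup>+w\<in>whitney_neighbourhood B (\<zeta> k). J w \<partial>lborel) \<le>
      ennreal N * (\<integral>\<^sup>+w\<in>upper_half_space. J w \<partial>lborel)"
proof -
  from W have l: "\<And>k. l k > 0" and un: "(\<Union>k. cube (\<zeta> k) (l k)) = upper_half_space"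
    unfolding whitney_decomposition_def by auto
  have "\<zeta> k \<in> cube (\<zeta> k) (l k)" for k using l[of k] by (intro center_in_cube) simp
  then have \<eta>: "snd (\<zeta> k) > 0" for k using un by (auto simp: upper_half_space_def)
  have sub: "whitney_neighbourhood B (\<zeta> k) \<subseteq> upper_half_space" for k
  proof
    fix w assume "w \<in> whitney_neighbourhood B (\<zeta> k)"
    then have "0 < B * snd w" using \<eta>[of k] by (auto simp: whitney_neighbourhood_def)
    then show "w \<in> upper_half_space" using B by (simp add: upper_half_space_def zero_less_mult_iff)
  qed
  obtain N where N: "N > 0" "\<And>w. (\<Sum>k. indicator (whitney_neighbourhood B (\<zeta> k)) w) \<le> ennreal N"
    using whitney_overlap[OF W B] by blast
  have "(\<Sum>k. \<integral>\<^sup>+w\<in>whitney_neighbourhood B (\<zeta> k). J w \<partial>lborel) \<le>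
      ennreal N * (\<integral>\<^sup>+w\<in>upper_half_space. J w \<partial>lborel)"
    if J[measurable]: "J \<in> borel_measurable borel" for J
  proof -
    have "(\<Sum>k. \<integral>\<^sup>+w\<in>whitney_neighbourhood B (\<zeta> k). J w \<partial>lborel) =
      (\<integral>\<^sup>+w. (\<Sum>k. J w * indicator (whitney_neighbourhood B (\<zeta> k)) w) \<partial>lborel)"
      by (intro nn_integral_suminf[symmetric]) measurable
    also have "\<dots> \<le> (\<integral>\<^sup>+w. ennreal N * (J w * indicator upper_half_space w) \<partial>lborel)"
    proof (rule nn_integral_mono)
      fix w :: "(real ^ 'n) \<times> real"
      show "(\<Sum>k. J w * indicator (whitney_neighbourhood B (\<zeta> k)) w) \<le>
          ennreal N * (J w * indicator upper_half_space w)"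
      proof (cases "w \<in> upper_half_space")
        case True
        then show ?thesis using mult_left_mono[OF N(2)[of w], of "J w"] by (simp add: mult.commute)
      next
        case False
        then have "indicator (whitney_neighbourhood B (\<zeta> k)) w = (0 :: ennreal)" for k
          using sub by (auto simp: indicator_def)
        then show ?thesis by simp
      qed
    qed
    also have "\<dots> = ennreal N * (\<integral>\<^sup>+w\<in>upper_half_space. J w \<partial>lborel)"
      by (intro nn_integral_cmult) measurable
    finally show ?thesis .
  qed
  with N(1) show ?thesis by blast
qed

text \<open>\<open>B\<close> depends on the decomposition alone and is fixed before the exponents,
  so that one family of neighbourhoods, with one overlap constant, serves all m functions.\<close>

lemma harmonic_powr_le_whitney_integral:
  fixes \<zeta> :: "nat \<Rightarrow> (real ^ 'n) \<times> real"
  assumes W: "whitney_decomposition upper_half_space \<zeta> l"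
  shows "\<exists>B>0. \<forall>s q a. 0 < s \<longrightarrow> 0 < q \<longrightarrow> (\<exists>C>0. \<forall>f k z. harmonic_on f upper_half_space \<longrightarrow>
    z \<in> cube (\<zeta> k) (l k) \<longrightarrow>
    ennreal (\<bar>f z\<bar> powr q * snd (\<zeta> k) powr (real CARD('n) + 1 + q * (real CARD('n) + 1 + a) / s)) \<le>
      ennreal C * (\<integral>\<^sup>+w\<in>whitney_neighbourhood B (\<zeta> k). Q_mean a s q f w \<partial>lborel))"
proof -
  let ?d = "real (CARD('n) + 1)"
  from W have l: "\<And>k. l k > 0" and un: "(\<Union>k. cube (\<zeta> k) (l k)) = upper_half_space"
    unfolding whitney_decomposition_def by auto
  have \<zeta>: "\<zeta> k \<in> cube (\<zeta> k) (l k)" for k using l[of k] by (intro center_in_cube) simp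
  obtain A where A: "A \<ge> 1" "\<And>k z. z \<in> cube (\<zeta> k) (l k) \<Longrightarrow> l k \<le> A * snd z"
    "\<And>k z. z \<in> cube (\<zeta> k) (l k) \<Longrightarrow> snd z \<le> A * l k"
    using whitney_decomposition_comparable[OF W] by blast
  have comp: "snd z \<le> A\<^sup>2 * snd v" if "z \<in> cube (\<zeta> k) (l k)" "v \<in> cube (\<zeta> k) (l k)" for k z v
  proof -
    have "snd z \<le> A * l k" by (rule A(3)[OF that(1)])
    also have "\<dots> \<le> A * (A * snd v)" using A(1) A(2)[OF that(2)] by (intro mult_left_mono) auto
    finally show ?thesis by (simp add: power2_eq_square mult.assoc)
  qed
  \<comment> \<open>The term ?d * A covers the distance from the center to a point of the cube. The
    term with the square covers the ball around that point and the comparison of heights.\<close>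
  define B where "B = 2 * A\<^sup>2 + ?d * A"
  have B: "B > 0" using A(1) by (simp add: B_def add_pos_nonneg)
  have sub: "cball z (snd z / 8) \<subseteq> whitney_neighbourhood B (\<zeta> k)" if z: "z \<in> cube (\<zeta> k) (l k)" for k z
  proof
    fix w assume w: "w \<in> cball z (snd z / 8)"
    have pos: "snd z > 0" "snd (\<zeta> k) > 0" using un z \<zeta>[of k] by (auto simp: upper_half_space_def)
    have "dist (\<zeta> k) w \<le> ?d * l k + snd z / 8"
      using dist_le_of_mem_cube[OF \<zeta> z] w dist_triangle[of "\<zeta> k" w z] by (simp add: add.commute)
    also have "\<dots> \<le> ?d * (A * snd (\<zeta> k)) + 2 * (A\<^sup>2 * snd (\<zeta> k))"
      using comp[OF z \<zeta>] A(2)[OF \<zeta>[of k]] pos by (intro add_mono mult_left_mono) auto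
    also have "\<dots> = B * snd (\<zeta> k)" by (simp add: B_def algebra_simps)
    finally have 1: "dist (\<zeta> k) w \<le> B * snd (\<zeta> k)" .
    have sw: "snd z \<le> 2 * snd w"
      using abs_snd_diff_le_dist[of z w] w pos by simp
    have "snd (\<zeta> k) \<le> A\<^sup>2 * snd z" by (rule comp[OF \<zeta> z])
    also have "\<dots> \<le> A\<^sup>2 * (2 * snd w)" by (intro mult_left_mono sw) auto
    also have "\<dots> = (2 * A\<^sup>2) * snd w" by simp
    also have "\<dots> \<le> B * snd w" using sw pos A(1) by (intro mult_right_mono) (auto simp: B_def)
    finally show "w \<in> whitney_neighbourhood B (\<zeta> k)"
      using 1 by (simp add: whitney_neighbourhood_def)
  qed
  have "\<exists>C>0. \<forall>f k z. harmonic_on f upper_half_space \<longrightarrow> z \<in> cube (\<zeta> k) (l k) \<longrightarrow>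
    ennreal (\<bar>f z\<bar> powr q * snd (\<zeta> k) powr (real CARD('n) + 1 + q * (real CARD('n) + 1 + a) / s)) \<le>
      ennreal C * (\<integral>\<^sup>+w\<in>whitney_neighbourhood B (\<zeta> k). Q_mean a s q f w \<partial>lborel)"
    if s: "0 < s" and q: "0 < q" for s q a
  proof -
    define e where "e = real CARD('n) + 1 + q * (real CARD('n) + 1 + a) / s"
    obtain C where C: "C > 0" "\<And>(f :: (real ^ 'n) \<times> real \<Rightarrow> real) z.
        harmonic_on f upper_half_space \<Longrightarrow> 0 < snd z \<Longrightarrow>
        ennreal (\<bar>f z\<bar> powr q * snd z powr e) \<le>
          ennreal C * (\<integral>\<^sup>+w\<in>cball z (snd z / 8). Q_mean a s q f w \<partial>lborel)"
      using harmonic_powr_le_integral_Q_mean[OF s q, where 'n='n and a=a] unfolding e_def by blast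
    define C' where "C' = A\<^sup>2 powr \<bar>e\<bar> * C"
    have "C' > 0" using A(1) C by (simp add: C'_def)
    moreover have "ennreal (\<bar>f z\<bar> powr q * snd (\<zeta> k) powr e) \<le>
      ennreal C' * (\<integral>\<^sup>+w\<in>whitney_neighbourhood B (\<zeta> k). Q_mean a s q f w \<partial>lborel)"
      if f: "harmonic_on f upper_half_space" and z: "z \<in> cube (\<zeta> k) (l k)" for f k z
    proof -
      have pos: "snd z > 0" "snd (\<zeta> k) > 0" using un z \<zeta>[of k] by (auto simp: upper_half_space_def)
      have "snd (\<zeta> k) powr e \<le> A\<^sup>2 powr \<bar>e\<bar> * snd z powr e"
        using A(1) pos comp[OF z \<zeta>] comp[OF \<zeta> z] by (intro powr_comparable) auto
      then have "ennreal (\<bar>f z\<bar> powr q * snd (\<zeta> k) powr e) \<le>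
          ennreal (\<bar>f z\<bar> powr q * (A\<^sup>2 powr \<bar>e\<bar> * snd z powr e))"
        by (intro ennreal_leI mult_left_mono) auto
      also have "\<dots> = ennreal (A\<^sup>2 powr \<bar>e\<bar>) * ennreal (\<bar>f z\<bar> powr q * snd z powr e)"
        by (simp add: mult_ac flip: ennreal_mult)
      also have "\<dots> \<le> ennreal (A\<^sup>2 powr \<bar>e\<bar>) *
          (ennreal C * (\<integral>\<^sup>+w\<in>cball z (snd z / 8). Q_mean a s q f w \<partial>lborel))"
        by (intro mult_left_mono C f pos) auto
      also have "\<dots> = ennreal C' * (\<integral>\<^sup>+w\<in>cball z (snd z / 8). Q_mean a s q f w \<partial>lborel)"
        using C by (simp add: C'_def ennreal_mult mult.assoc)
      also have "\<dots> \<le> ennreal C' * (\<integral>\<^sup>+w\<in>whitney_neighbourhood B (\<zeta> k). Q_mean a s q f w \<partial>lborel)"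
        using sub[OF z] by (intro mult_left_mono nn_integral_mono) (auto simp: indicator_def)
      finally show ?thesis .
    qed
    ultimately show ?thesis unfolding e_def by blast
  qed
  with B show ?thesis by blast
qed

lemma carleson_inequality_of_whitney:
  fixes \<mu> :: "((real ^ 'n) \<times> real) measure" and p \<sigma> \<alpha> :: "'i \<Rightarrow> real"
  assumes I: "finite I" "I \<noteq> {}"
    and p: "\<And>i. i \<in> I \<Longrightarrow> 0 < p i" and \<sigma>: "\<And>i. i \<in> I \<Longrightarrow> 0 < \<sigma> i"
    and \<mu>: "sets \<mu> = sets (restrict_space borel upper_half_space)"
    and W: "whitney_decomposition upper_half_space \<zeta> l"
    and C: "0 < C"
    and \<mu>_le: "\<And>k. emeasure \<mu> (cube (\<zeta> k) (l k)) \<le> ennreal (C * snd (\<zeta> k) powr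
      (\<Sum>i\<in>I. real CARD('n) + 1 + p i * (real CARD('n) + 1 + \<alpha> i) / \<sigma> i))"
  shows "\<exists>C>0. \<forall>f. (\<forall>i\<in>I. harmonic_on (f i) upper_half_space) \<longrightarrow>
    (\<integral>\<^sup>+z. ennreal (\<Prod>i\<in>I. \<bar>f i z\<bar> powr p i) \<partial>\<mu>) \<le>
      ennreal C * (\<Prod>i\<in>I. \<integral>\<^sup>+w\<in>upper_half_space. Q_mean (\<alpha> i) (\<sigma> i) (p i) (f i) w \<partial>lborel)"
proof -
  from W have l: "\<And>k. l k > 0" and un: "(\<Union>k. cube (\<zeta> k) (l k)) = upper_half_space"
    unfolding whitney_decomposition_def by auto
  have "\<zeta> k \<in> cube (\<zeta> k) (l k)" for k using l[of k] by (intro center_in_cube) simp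
  then have \<eta>: "snd (\<zeta> k) > 0" for k using un by (auto simp: upper_half_space_def)
  define e where "e i = real CARD('n) + 1 + p i * (real CARD('n) + 1 + \<alpha> i) / \<sigma> i" for i
  obtain B where B: "B > 0" and "\<forall>s q a. 0 < s \<longrightarrow> 0 < q \<longrightarrow> (\<exists>C>0. \<forall>f k z. harmonic_on f upper_half_space \<longrightarrow>
    z \<in> cube (\<zeta> k) (l k) \<longrightarrow>
    ennreal (\<bar>f z\<bar> powr q * snd (\<zeta> k) powr (real CARD('n) + 1 + q * (real CARD('n) + 1 + a) / s)) \<le>
      ennreal C * (\<integral>\<^sup>+w\<in>whitney_neighbourhood B (\<zeta> k). Q_mean a s q f w \<partial>lborel))"
    using harmonic_powr_le_whitney_integral[OF W] by (elim exE conjE) (rule that)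
  then have "\<forall>i\<in>I. \<exists>C>0. \<forall>f k z. harmonic_on f upper_half_space \<longrightarrow> z \<in> cube (\<zeta> k) (l k) \<longrightarrow>
    ennreal (\<bar>f z\<bar> powr p i * snd (\<zeta> k) powr e i) \<le>
      ennreal C * (\<integral>\<^sup>+w\<in>whitney_neighbourhood B (\<zeta> k). Q_mean (\<alpha> i) (\<sigma> i) (p i) f w \<partial>lborel)"
    using p \<sigma> unfolding e_def by simp
  from bchoice[OF this] obtain c where
    c_spec: "\<forall>i\<in>I. c i > 0 \<and> (\<forall>f k z. harmonic_on f upper_half_space \<longrightarrow> z \<in> cube (\<zeta> k) (l k) \<longrightarrow>
      ennreal (\<bar>f z\<bar> powr p i * snd (\<zeta> k) powr e i) \<le>
      ennreal (c i) * (\<integral>\<^sup>+w\<in>whitney_neighbourhood B (\<zeta> k). Q_mean (\<alpha> i) (\<sigma> i) (p i) f w \<partial>lborel))" ..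
  then have c: "c i > 0" if "i \<in> I" for i using that by blast
  have local: "ennreal (\<bar>f z\<bar> powr p i * snd (\<zeta> k) powr e i) \<le>
      ennreal (c i) * (\<integral>\<^sup>+w\<in>whitney_neighbourhood B (\<zeta> k). Q_mean (\<alpha> i) (\<sigma> i) (p i) f w \<partial>lborel)"
    if "i \<in> I" "harmonic_on f upper_half_space" "z \<in> cube (\<zeta> k) (l k)" for i f k z
    using c_spec[THEN bspec, OF that(1), THEN conjunct2] that(2,3) by blast
  obtain N where N: "N > 0" and overlap: "\<And>J. J \<in> borel_measurable borel \<Longrightarrow>
    (\<Sum>k. \<integral>\<^sup>+w\<in>whitney_neighbourhood B (\<zeta> k). J w \<partial>lborel) \<le>
      ennreal N * (\<integral>\<^sup>+w\<in>upper_half_space. J w \<partial>lborel)"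
    using suminf_whitney_integral_le[OF W B] by blast
  define C' where "C' = C * (\<Prod>i\<in>I. c i) * N ^ card I"
  have "C' > 0" using C c N by (simp add: C'_def prod_pos)
  moreover have "(\<integral>\<^sup>+z. ennreal (\<Prod>i\<in>I. \<bar>f i z\<bar> powr p i) \<partial>\<mu>) \<le>
      ennreal C' * (\<Prod>i\<in>I. \<integral>\<^sup>+w\<in>upper_half_space. Q_mean (\<alpha> i) (\<sigma> i) (p i) (f i) w \<partial>lborel)"
    if f: "\<forall>i\<in>I. harmonic_on (f i) upper_half_space" for f
  proof -
    define J where "J i = Q_mean (\<alpha> i) (\<sigma> i) (p i) (f i)" for i
    define b where "b i k = (\<integral>\<^sup>+w\<in>whitney_neighbourhood B (\<zeta> k). J i w \<partial>lborel)" for i k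
    define E where "E = (\<Sum>i\<in>I. e i)"
    have J: "J i \<in> borel_measurable borel" if "i \<in> I" for i
      unfolding J_def using f that \<sigma> by (intro borel_measurable_Q_mean harmonic_on_imp_continuous_on) auto
    \<comment> \<open>A bound for the integrand constant on the k-th cube; its negative power of the
      height is cancelled by the growth condition on \<open>\<mu>\<close>.\<close>
    let ?c = "\<lambda>k. ennreal (snd (\<zeta> k) powr - E) * (ennreal (\<Prod>i\<in>I. c i) * (\<Prod>i\<in>I. b i k))"
    have pt: "ennreal (\<Prod>i\<in>I. \<bar>f i z\<bar> powr p i) \<le> ?c k" if z: "z \<in> cube (\<zeta> k) (l k)" for k z
    proof -
      have "(\<Prod>i\<in>I. \<bar>f i z\<bar> powr p i * snd (\<zeta> k) powr e i) =
          (\<Prod>i\<in>I. \<bar>f i z\<bar> powr p i) * snd (\<zeta> k) powr E"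
        using \<eta>[of k] I by (simp add: prod.distrib E_def powr_sum)
      then have "ennreal (\<Prod>i\<in>I. \<bar>f i z\<bar> powr p i) =
        ennreal (snd (\<zeta> k) powr - E) * (\<Prod>i\<in>I. ennreal (\<bar>f i z\<bar> powr p i * snd (\<zeta> k) powr e i))"
        using \<eta>[of k] by (simp add: prod_ennreal prod_nonneg powr_minus flip: ennreal_mult)
      also have "\<dots> \<le> ennreal (snd (\<zeta> k) powr - E) * (\<Prod>i\<in>I. ennreal (c i) * b i k)"
        using f z unfolding b_def J_def by (intro mult_left_mono prod_mono_ennreal local) auto
      also have "\<dots> = ?c k"
        using c by (simp add: prod.distrib prod_ennreal less_imp_le)
      finally show ?thesis .
    qed
    have cs: "cube (\<zeta> k) (l k) \<in> sets \<mu>" for k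
      using un by (auto simp: \<mu> sets_restrict_space_iff)
    have sp: "space \<mu> = upper_half_space"
      using sets_eq_imp_space_eq[OF \<mu>] by (simp add: space_restrict_space)
    \<comment> \<open>The closed cubes share faces, which \<open>\<mu>\<close> may charge; covering
      the half-space suffices for an upper bound.\<close>
    have "(\<integral>\<^sup>+z. ennreal (\<Prod>i\<in>I. \<bar>f i z\<bar> powr p i) \<partial>\<mu>) \<le>
        (\<integral>\<^sup>+z. (\<Sum>k. ?c k * indicator (cube (\<zeta> k) (l k)) z) \<partial>\<mu>)"
    proof (rule nn_integral_mono)
      fix z assume "z \<in> space \<mu>"
      then obtain k where k: "z \<in> cube (\<zeta> k) (l k)" using un sp by auto
      have "ennreal (\<Prod>i\<in>I. \<bar>f i z\<bar> powr p i) \<le> ?c k * indicator (cube (\<zeta> k) (l k)) z"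
        using pt[OF k] k by simp
      also have "\<dots> \<le> (\<Sum>k. ?c k * indicator (cube (\<zeta> k) (l k)) z)"
        by (rule le_suminf_ennreal)
      finally show "ennreal (\<Prod>i\<in>I. \<bar>f i z\<bar> powr p i) \<le> (\<Sum>k. ?c k * indicator (cube (\<zeta> k) (l k)) z)" .
    qed
    also have "\<dots> = (\<Sum>k. \<integral>\<^sup>+z. ?c k * indicator (cube (\<zeta> k) (l k)) z \<partial>\<mu>)"
      using cs by (intro nn_integral_suminf borel_measurable_times_ennreal borel_measurable_indicator) auto
    also have "\<dots> = (\<Sum>k. ?c k * emeasure \<mu> (cube (\<zeta> k) (l k)))"
      using cs by (simp add: nn_integral_cmult_indicator)
    also have "\<dots> \<le> (\<Sum>k. ennreal (C * (\<Prod>i\<in>I. c i)) * (\<Prod>i\<in>I. b i k))"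
    proof (intro suminf_le summableI)
      fix k
      have "?c k * emeasure \<mu> (cube (\<zeta> k) (l k)) \<le> ?c k * ennreal (C * snd (\<zeta> k) powr E)"
        using \<mu>_le[of k] unfolding E_def e_def by (intro mult_left_mono) auto
      also have "\<dots> = (ennreal (snd (\<zeta> k) powr - E) * ennreal (C * snd (\<zeta> k) powr E)) *
          (ennreal (\<Prod>i\<in>I. c i) * (\<Prod>i\<in>I. b i k))"
        by (simp only: mult_ac)
      also have "ennreal (snd (\<zeta> k) powr - E) * ennreal (C * snd (\<zeta> k) powr E) = ennreal C"
        using \<eta>[of k] C by (simp add: powr_minus flip: ennreal_mult)
      also have "ennreal C * (ennreal (\<Prod>i\<in>I. c i) * (\<Prod>i\<in>I. b i k)) =
          ennreal (C * (\<Prod>i\<in>I. c i)) * (\<Prod>i\<in>I. b i k)"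
        using C c by (simp add: ennreal_mult prod_nonneg less_imp_le mult.assoc)
      finally show "?c k * emeasure \<mu> (cube (\<zeta> k) (l k)) \<le> ennreal (C * (\<Prod>i\<in>I. c i)) * (\<Prod>i\<in>I. b i k)" .
    qed
    also have "\<dots> = ennreal (C * (\<Prod>i\<in>I. c i)) * (\<Sum>k. \<Prod>i\<in>I. b i k)" by simp
    also have "\<dots> \<le> ennreal (C * (\<Prod>i\<in>I. c i)) * (\<Prod>i\<in>I. \<Sum>k. b i k)"
      by (intro mult_left_mono suminf_prod_le_ennreal I) auto
    also have "\<dots> \<le> ennreal (C * (\<Prod>i\<in>I. c i)) *
        (\<Prod>i\<in>I. ennreal N * (\<integral>\<^sup>+w\<in>upper_half_space. J i w \<partial>lborel))"
      unfolding b_def by (intro mult_left_mono prod_mono_ennreal overlap J) auto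
    also have "\<dots> = ennreal C' * (\<Prod>i\<in>I. \<integral>\<^sup>+w\<in>upper_half_space. J i w \<partial>lborel)"
      using N C c by (simp add: prod.distrib C'_def ennreal_mult prod_nonneg less_imp_le ennreal_power mult.assoc)
    finally show ?thesis by (simp add: J_def)
  qed
  ultimately show ?thesis by blast
qed

subsection \<open>A rapidly decaying harmonic function\<close>

text \<open>A complex coordinate in a coordinate plane. The squares of its partial derivatives add
  up to 1 + i^2 = 0, which makes its powers harmonic.\<close>

definition planar :: "'a::euclidean_space \<Rightarrow> 'a \<Rightarrow> 'a \<Rightarrow> complex" where
  "planar b b' z = Complex (z \<bullet> b) (z \<bullet> b')"

lemma bounded_linear_planar: "bounded_linear (planar b b')"
proof -
  have "planar b b' = (\<lambda>z. complex_of_real (z \<bullet> b) + \<i> * complex_of_real (z \<bullet> b'))"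
    by (simp add: planar_def fun_eq_iff complex_eq_iff)
  then show ?thesis
    by (simp add: bounded_linear_add bounded_linear_const_mult bounded_linear_of_real
        bounded_linear_compose[OF bounded_linear_of_real bounded_linear_inner_left])
qed

lemma norm_planar_le:
  assumes "b \<in> Basis" "b' \<in> Basis" "b \<noteq> b'"
  shows "norm (planar b b' z) \<le> norm z"
proof -
  have "(z \<bullet> b)\<^sup>2 + (z \<bullet> b')\<^sup>2 = (\<Sum>c\<in>{b, b'}. (z \<bullet> c)\<^sup>2)"
    using assms by simp
  also have "\<dots> \<le> (\<Sum>c\<in>Basis. (z \<bullet> c)\<^sup>2)"
    using assms by (intro sum_mono2) auto
  also have "\<dots> = (norm z)\<^sup>2"
    by (simp add: power2_norm_eq_inner euclidean_inner[of z z] flip: power2_eq_square)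
  finally show ?thesis
    by (simp add: planar_def cmod_def real_le_lsqrt)
qed

text \<open>The Kelvin transform of the harmonic polynomial \<open>Re (z\<^sub>b + i z\<^sub>b')\<^sup>N\<close>.\<close>

definition kelvin :: "'a::euclidean_space \<Rightarrow> 'a \<Rightarrow> nat \<Rightarrow> 'a \<Rightarrow> real" where
  "kelvin b b' N z =
     (z \<bullet> z) powr (1 - real DIM('a) / 2 - real N) * Re (planar b b' z ^ N)"

text \<open>For h harmonic and homogeneous of degree N, the Laplacian of |z|^(2a) h is 2 a
  |z|^(2a-2) h (d + 2 (a - 1) + 2 N), with d the dimension. The exponent in \<open>kelvin\<close> is
  the a that makes the last factor vanish.\<close>

lemma harmonic_on_kelvin:
  fixes b b' :: "'a::euclidean_space"
  assumes b: "b \<in> Basis" "b' \<in> Basis" "b \<noteq> b'" and S: "open S" "w \<notin> S"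
  shows "harmonic_on (\<lambda>z. kelvin b b' N (z - w)) S"
proof -
  define a where "a = 1 - real DIM('a) / 2 - real N"
  let ?u = "planar b b'"
  interpret u: bounded_linear ?u by (rule bounded_linear_planar)
  define h where "h z = Re (?u z ^ N)" for z
  define h1 where "h1 z v = Re (of_nat N * ?u z ^ (N - 1) * ?u v)" for z v
  \<comment> \<open>The truncated exponent N - 1 - 1 is harmless: for N below 2 the coefficient N (N
    - 1) is 0.\<close>
  define h2 where "h2 z c v = Re (of_nat N * (of_nat (N - 1) * ?u z ^ (N - 1 - 1) * ?u v) * ?u c)" for z c v
  define r where "r e z = (z \<bullet> z) powr e" for e and z :: 'a
  define f' where "f' z v = 2 * a * (z \<bullet> v) * r (a - 1) z * h z + r a z * h1 z v" for z v
  define f'' where "f'' c z v = 2 * a * (v \<bullet> c) * r (a - 1) z * h z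
     + 2 * a * (z \<bullet> c) * (2 * (a - 1) * (z \<bullet> v) * r (a - 2) z) * h z
     + 2 * a * (z \<bullet> c) * r (a - 1) z * h1 z v
     + 2 * a * (z \<bullet> v) * r (a - 1) z * h1 z c + r a z * h2 z c v" for c z v
  have du: "(?u has_derivative ?u) (at z)" for z by (rule bounded_linear_imp_has_derivative[OF bounded_linear_planar])
  have dh: "(h has_derivative h1 z) (at z)" for z
    unfolding h_def h1_def
    by (rule has_derivative_eq_rhs, rule derivative_intros, rule has_derivative_power[OF du])
      (simp add: fun_eq_iff mult_ac)
  have dh1: "((\<lambda>z. h1 z c) has_derivative h2 z c) (at z)" for z c
    unfolding h1_def h2_def
    by (rule has_derivative_eq_rhs, rule derivative_intros, rule has_derivative_mult_left,
        rule has_derivative_mult_right, rule has_derivative_power[OF du])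
      (simp add: fun_eq_iff mult_ac)
  have dr: "(r e has_derivative (\<lambda>v. 2 * e * (z \<bullet> v) * r (e - 1) z)) (at z)" if "z \<noteq> 0" for e and z :: 'a
  proof -
    have "((\<lambda>z. z \<bullet> z) has_derivative (\<lambda>v. 2 * (z \<bullet> v))) (at z)"
      by (auto intro!: derivative_eq_intros simp: inner_commute)
    moreover have "((\<lambda>s. s powr e) has_derivative (\<lambda>k. k * (e * (z \<bullet> z) powr (e - 1)))) (at (z \<bullet> z))"
      using has_real_derivative_powr[of "z \<bullet> z" e] that
      by (simp add: has_field_derivative_def mult_commute_abs)
    ultimately show ?thesis
      unfolding r_def using has_derivative_compose by (fastforce simp: mult_ac)
  qed
  have K: "kelvin b b' N = (\<lambda>z. r a z * h z)"
    by (simp add: kelvin_def r_def h_def a_def fun_eq_iff)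
  have dK: "(kelvin b b' N has_derivative f' z) (at z)" if "z \<noteq> 0" for z
    unfolding K by (rule has_derivative_eq_rhs, rule has_derivative_mult[OF dr[OF that] dh])
      (simp add: f'_def fun_eq_iff algebra_simps)
  have df': "((\<lambda>z. f' z c) has_derivative f'' c z) (at z)" if z: "z \<noteq> 0" for z c
  proof -
    have "((\<lambda>z. z \<bullet> c) has_derivative (\<lambda>v. v \<bullet> c)) (at z)"
      by (auto intro!: derivative_eq_intros)
    note D = has_derivative_add[OF has_derivative_mult[OF has_derivative_mult[OF
          has_derivative_mult_right[OF this, of "2 * a"] dr[OF z, of "a - 1"]] dh]
        has_derivative_mult[OF dr[OF z, of a] dh1[of c]]]
    show ?thesis
      unfolding f'_def
      by (rule has_derivative_eq_rhs, rule D) (simp add: f''_def fun_eq_iff algebra_simps)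
  qed
  have inner_sum: "(\<Sum>c\<in>Basis. (z \<bullet> c) * (z \<bullet> c)) = z \<bullet> z" for z :: 'a
    by (rule euclidean_inner[symmetric])
  \<comment> \<open>Euler's identity for the homogeneous polynomial \<open>h\<close>.\<close>
  have sum_h1: "(\<Sum>c\<in>Basis. (z \<bullet> c) * h1 z c) = real N * h z" for z
  proof -
    have "(\<Sum>c\<in>Basis. (z \<bullet> c) * h1 z c) = Re (of_nat N * ?u z ^ (N - 1) * (\<Sum>c\<in>Basis. (z \<bullet> c) *\<^sub>R ?u c))"
      by (simp add: h1_def sum_distrib_left)
    also have "(\<Sum>c\<in>Basis. (z \<bullet> c) *\<^sub>R ?u c) = ?u z"
      by (simp flip: u.scaleR u.sum add: euclidean_representation)
    finally show ?thesis
      by (cases N) (simp_all add: h_def mult_ac)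
  qed
  have sum_h2: "(\<Sum>c\<in>Basis. h2 z c c) = 0" for z
  proof -
    have "(\<Sum>c\<in>Basis. ?u c * ?u c) = 0"
    proof -
      have uc: "?u c * ?u c = (if c = b then 1 else 0) - (if c = b' then 1 else 0)" if "c \<in> Basis" for c
        using b that by (auto simp: planar_def inner_Basis complex_eq_iff)
      show ?thesis using b by (simp add: uc sum_subtractf)
    qed
    then have "Re (of_nat N * (of_nat (N - 1) * ?u z ^ (N - 1 - 1)) * (\<Sum>c\<in>Basis. ?u c * ?u c)) = 0"
      by simp
    then show ?thesis
      by (simp add: h2_def sum_distrib_left mult_ac)
  qed
  have lap: "(\<Sum>c\<in>Basis. f'' c z c) = 0" if z: "z \<noteq> 0" for z
  proof -
    have rz: "r (a - 2) z * (z \<bullet> z) = r (a - 1) z"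
      using powr_mult_base[of "z \<bullet> z" "a - 2"] by (simp add: r_def mult.commute)
    have "(\<Sum>c\<in>Basis. f'' c z c) = 2 * a * real DIM('a) * r (a - 1) z * h z
       + 4 * a * (a - 1) * (r (a - 2) z * (\<Sum>c\<in>Basis. (z \<bullet> c) * (z \<bullet> c))) * h z
       + 4 * a * r (a - 1) z * (\<Sum>c\<in>Basis. (z \<bullet> c) * h1 z c) + r a z * (\<Sum>c\<in>Basis. h2 z c c)"
      by (simp add: f''_def sum.distrib sum_subtractf sum_distrib_left sum_distrib_right algebra_simps)
    also have "\<dots> = 2 * a * r (a - 1) z * h z * (real DIM('a) + 2 * (a - 1) + 2 * real N)"
      unfolding inner_sum rz sum_h1 sum_h2 by (simp add: algebra_simps)
    also have "\<dots> = 0" by (simp add: a_def)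
    finally show ?thesis .
  qed
  have ds: "((\<lambda>z. z - w) has_derivative (\<lambda>v. v)) (at z)" for z
    by (auto intro!: derivative_eq_intros)
  have nz: "z - w \<noteq> 0" if "z \<in> S" for z using that S by auto
  show ?thesis
  proof (rule harmonic_onI[OF S(1)])
    show "((\<lambda>z. kelvin b b' N (z - w)) has_derivative f' (z - w)) (at z)" if "z \<in> S" for z
      by (rule has_derivative_compose[OF ds dK[OF nz[OF that]]])
    show "((\<lambda>z. f' (z - w) c) has_derivative f'' c (z - w)) (at z)" if "z \<in> S" for z c
      by (rule has_derivative_compose[OF ds df'[OF nz[OF that]]])
    show "continuous_on S (\<lambda>z. f'' c (z - w) v)" for c v
      unfolding f''_def r_def h_def h1_def h2_def
      by (intro continuous_intros continuous_on_compose2[OF u.continuous_on[OF continuous_on_id]])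
        (use nz in auto)
    show "(\<Sum>c\<in>Basis. f'' c (z - w) c) = 0" if "z \<in> S" for z
      by (rule lap[OF nz[OF that]])
  qed
qed

text \<open>Homogeneity is what transports estimates at height 1 to every height.\<close>

lemma kelvin_scaleR:
  fixes z :: "'a::euclidean_space"
  assumes "0 < s"
  shows "kelvin b b' N (s *\<^sub>R z) = s powr - (real DIM('a) + real N - 2) * kelvin b b' N z"
proof -
  interpret u: bounded_linear "planar b b'" by (rule bounded_linear_planar)
  define a where "a = 1 - real DIM('a) / 2 - real N"
  have e: "2 * a + real N = - (real DIM('a) + real N - 2)" by (simp add: a_def algebra_simps)
  have "(s *\<^sub>R z \<bullet> s *\<^sub>R z) powr a = s powr (2 * a) * (z \<bullet> z) powr a"
    using assms powr_powr[of s 2 a] by (simp add: powr_mult mult.assoc[symmetric] power2_eq_square)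
  moreover have "planar b b' (s *\<^sub>R z) ^ N = (s powr real N) *\<^sub>R planar b b' z ^ N"
    using assms by (simp add: u.scaleR powr_realpow scaleR_power)
  moreover have "s powr (2 * a) * s powr real N = s powr - (real DIM('a) + real N - 2)"
    by (simp add: e flip: powr_add)
  ultimately show ?thesis
    by (simp add: kelvin_def a_def[symmetric] mult_ac)
qed

lemma abs_kelvin_le:
  fixes z :: "'a::euclidean_space"
  assumes b: "b \<in> Basis" "b' \<in> Basis" "b \<noteq> b'" and z: "z \<noteq> 0"
  shows "\<bar>kelvin b b' N z\<bar> \<le> norm z powr - (real DIM('a) + real N - 2)"
proof -
  define a where "a = 1 - real DIM('a) / 2 - real N"
  have e: "2 * a + real N = - (real DIM('a) + real N - 2)" by (simp add: a_def algebra_simps)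
  have "\<bar>Re (planar b b' z ^ N)\<bar> \<le> norm (planar b b' z) ^ N"
    using abs_Re_le_cmod[of "planar b b' z ^ N"] by (simp add: norm_power)
  also have "\<dots> \<le> norm z ^ N"
    by (intro power_mono norm_planar_le b) auto
  also have "\<dots> = norm z powr real N" using z by (simp add: powr_realpow)
  finally have "\<bar>kelvin b b' N z\<bar> \<le> (z \<bullet> z) powr a * norm z powr real N"
    by (simp add: kelvin_def a_def abs_mult mult_left_mono)
  also have "(z \<bullet> z) powr a = norm z powr (2 * a)"
    using z powr_powr[of "norm z" 2 a] by (simp add: dot_square_norm)
  also have "norm z powr (2 * a) * norm z powr real N = norm z powr - (real DIM('a) + real N - 2)"
    by (simp add: e flip: powr_add)
  finally show ?thesis .
qed

lemma kelvin_pos: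
  assumes "b \<in> Basis" "b' \<in> Basis" "b \<noteq> b'" "0 < s"
  shows "0 < kelvin b b' N (s *\<^sub>R b)"
proof -
  have "planar b b' (s *\<^sub>R b) = complex_of_real s"
    using assms by (simp add: planar_def inner_Basis complex_eq_iff)
  then show ?thesis
    using assms by (simp add: kelvin_def flip: of_real_power)
qed

text \<open>The vector from the reflected point to \<open>w\<close> is 2 s b, with s the height of
  \<open>w\<close> and b the vertical unit vector. \<open>kelvin\<close> is positive there, so
  continuity at the single point 2 b and scaling by s give the lower bound on the ball.\<close>

lemma ex_decaying_harmonic:
  "\<exists>K :: (real ^ 'n) \<times> real \<Rightarrow> real. \<exists>c>0. \<exists>\<epsilon>>0. \<epsilon> < 1 \<and>
    (\<forall>w. 0 < snd w \<longrightarrow> harmonic_on (\<lambda>z. K (z - (fst w, - snd w))) upper_half_space) \<and>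
    (\<forall>z. z \<noteq> 0 \<longrightarrow> \<bar>K z\<bar> \<le> norm z powr - (real CARD('n) - 1 + real N)) \<and>
    (\<forall>w z. 0 < snd w \<longrightarrow> z \<in> ball w (\<epsilon> * snd w) \<longrightarrow>
       c * snd w powr - (real CARD('n) - 1 + real N) \<le> K (z - (fst w, - snd w)))"
proof -
  \<comment> \<open>A horizontal axis exists because n is at least 1; together with the vertical one
    it spans the plane of \<open>planar\<close>.\<close>
  obtain i :: 'n where True by simp
  define b :: "(real ^ 'n) \<times> real" where "b = (0, 1)"
  define b' :: "(real ^ 'n) \<times> real" where "b' = (axis i 1, 0)"
  have b: "b \<in> Basis" "b' \<in> Basis" "b \<noteq> b'"
    by (auto simp: b_def b'_def Basis_prod_def axis_in_Basis_iff)
  define K where "K = kelvin b b' N"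
  define M where "M = real CARD('n) - 1 + real N"
  have M: "real DIM((real ^ 'n) \<times> real) + real N - 2 = M" by (simp add: M_def)
  have pole: "(fst w, - snd w) \<notin> upper_half_space" if "0 < snd w" for w :: "(real ^ 'n) \<times> real"
    using that by (simp add: upper_half_space_def)
  have harm: "harmonic_on (\<lambda>z. K (z - (fst w, - snd w))) upper_half_space" if "0 < snd w" for w
    unfolding K_def by (rule harmonic_on_kelvin[OF b open_upper_half_space pole[OF that]])
  have le: "\<bar>K z\<bar> \<le> norm z powr - M" if "z \<noteq> 0" for z
    unfolding K_def using abs_kelvin_le[OF b that, of N] unfolding M .
  define c where "c = K (2 *\<^sub>R b) / 2"
  have c: "c > 0" unfolding c_def K_def using kelvin_pos[OF b, of 2 N] by simp
  have "harmonic_on (\<lambda>z. K (z - 0)) (- {0})"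
    unfolding K_def by (rule harmonic_on_kelvin[OF b]) auto
  then have "continuous_on (- {0}) K" using harmonic_on_imp_continuous_on by fastforce
  moreover have "2 *\<^sub>R b \<in> - {0}" by (simp add: b_def zero_prod_def)
  ultimately have "isCont K (2 *\<^sub>R b)"
    by (simp add: continuous_on_eq_continuous_at open_Compl)
  then obtain \<delta> where \<delta>: "\<delta> > 0" "\<And>v. dist v (2 *\<^sub>R b) < \<delta> \<Longrightarrow> dist (K v) (K (2 *\<^sub>R b)) < c"
    using c unfolding continuous_at_eps_delta by blast
  define \<epsilon> where "\<epsilon> = min \<delta> (1 / 2)"
  have \<epsilon>: "\<epsilon> > 0" "\<epsilon> < 1" using \<delta>(1) by (auto simp: \<epsilon>_def)
  have "c * snd w powr - M \<le> K (z - (fst w, - snd w))"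
    if w: "0 < snd w" and z: "z \<in> ball w (\<epsilon> * snd w)" for w z
  proof -
    define s where "s = snd w"
    have s: "s > 0" using w by (simp add: s_def)
    \<comment> \<open>The vector from the pole to \<open>z\<close>, rescaled to height 1; it lies
      within \<open>\<epsilon>\<close> of 2 b.\<close>
    define v where "v = 2 *\<^sub>R b + (1 / s) *\<^sub>R (z - w)"
    have "dist v (2 *\<^sub>R b) = dist w z / s"
      using s by (simp add: v_def dist_norm norm_minus_commute)
    also have "\<dots> < \<epsilon>" using z s by (simp add: s_def divide_less_eq)
    finally have "dist (K v) (K (2 *\<^sub>R b)) < c" by (intro \<delta>) (simp add: \<epsilon>_def)
    moreover have "K (2 *\<^sub>R b) = 2 * c" by (simp add: c_def)
    ultimately have "c \<le> K v" unfolding dist_real_def by linarith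
    moreover have "z - (fst w, - snd w) = s *\<^sub>R v"
      using s by (simp add: v_def b_def scaleR_add_right) (simp add: prod_eq_iff s_def)
    moreover have "K (s *\<^sub>R v) = s powr - M * K v"
      unfolding K_def kelvin_scaleR[OF s] M ..
    ultimately show ?thesis using s by (simp add: s_def mult.commute mult_right_mono)
  qed
  with c \<epsilon> harm le show ?thesis unfolding M_def by blast
qed

subsection \<open>Necessity of the growth condition\<close>

text \<open>Replaces polar coordinates by dyadic shells. Shell j is enclosed in a ball of radius
  2^(j+1) r, and the shells contribute a geometric series of ratio 2^(d - \<kappa>), less than 1,
  where d is the dimension.\<close>

lemma nn_integral_norm_powr_le:
  assumes \<kappa>: "real DIM('a::euclidean_space) < \<kappa>"
  shows "\<exists>C>0. \<forall>(a :: 'a) r. 0 < r \<longrightarrow>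
    (\<integral>\<^sup>+z\<in>{z. r \<le> norm (z - a)}. ennreal (norm (z - a) powr - \<kappa>) \<partial>lborel) \<le>
      ennreal (C * r powr (real DIM('a) - \<kappa>))"
proof -
  let ?d = "real DIM('a)"
  define q where "q = 2 powr (?d - \<kappa>)"
  have q: "0 < q" "q < 1" using \<kappa> by (auto simp: q_def powr_less_one)
  define V where "V = unit_ball_vol ?d"
  have V: "V > 0" by (simp add: V_def)
  define C where "C = V * 2 powr ?d / (1 - q)"
  have "C > 0" using V q by (simp add: C_def)
  moreover have "(\<integral>\<^sup>+z\<in>{z. r \<le> norm (z - a)}. ennreal (norm (z - a) powr - \<kappa>) \<partial>lborel) \<le>
      ennreal (C * r powr (?d - \<kappa>))" if r: "0 < r" for a :: 'a and r
  proof -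
    let ?g = "\<lambda>j z. ennreal ((2 ^ j * r) powr - \<kappa>) * indicator (cball a (2 ^ (j + 1) * r)) z"
    have "(\<integral>\<^sup>+z\<in>{z. r \<le> norm (z - a)}. ennreal (norm (z - a) powr - \<kappa>) \<partial>lborel) \<le>
        (\<integral>\<^sup>+z. (\<Sum>j. ?g j z) \<partial>lborel)"
    proof (rule nn_integral_mono)
      fix z :: 'a
      show "ennreal (norm (z - a) powr - \<kappa>) * indicator {z. r \<le> norm (z - a)} z \<le> (\<Sum>j. ?g j z)"
      proof (cases "r \<le> norm (z - a)")
        case True
        \<comment> \<open>The least n with this property is positive, and shell n - 1 contains
          \<open>z\<close>.\<close>
        define P where "P n \<longleftrightarrow> norm (z - a) < 2 ^ n * r" for n :: nat
        obtain n0 where "norm (z - a) / r < 2 ^ n0"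
          using real_arch_pow[of 2 "norm (z - a) / r"] by auto
        then have "P n0" using r by (simp add: P_def divide_less_eq)
        then obtain n where n: "P n" "\<And>m. m < n \<Longrightarrow> \<not> P m"
          using exists_least_iff[of P] by blast
        have "n \<noteq> 0" using n(1) True by (auto simp: P_def intro: gr0I)
        then obtain j where j: "n = j + 1" by (cases n) auto
        have lo: "2 ^ j * r \<le> norm (z - a)" using n(2)[of j] j by (simp add: P_def)
        have hi: "z \<in> cball a (2 ^ (j + 1) * r)"
          using n(1) j by (simp add: P_def dist_norm norm_minus_commute)
        have "ennreal (norm (z - a) powr - \<kappa>) \<le> ennreal ((2 ^ j * r) powr - \<kappa>)"
          using lo r \<kappa> by (intro ennreal_leI powr_mono2') (auto intro: order_trans[OF of_nat_0_le_iff less_imp_le])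
        also have "\<dots> = ?g j z" using hi by simp
        also have "\<dots> \<le> (\<Sum>j. ?g j z)" by (rule le_suminf_ennreal)
        finally show ?thesis using True by simp
      qed simp
    qed
    also have "\<dots> = (\<Sum>j. \<integral>\<^sup>+z. ?g j z \<partial>lborel)"
      by (intro nn_integral_suminf borel_measurable_times_ennreal borel_measurable_indicator) auto
    also have "\<dots> = (\<Sum>j. ennreal (V * 2 powr ?d * r powr (?d - \<kappa>) * q ^ j))"
    proof (intro suminf_cong)
      fix j :: nat
      have "(2 ^ j * r) powr - \<kappa> * (2 ^ (j + 1) * r) ^ DIM('a) = 2 powr ?d * r powr (?d - \<kappa>) * q ^ j"
      proof -
        have "(2 ^ j * r) powr - \<kappa> = 2 powr (- \<kappa> * real j) * r powr - \<kappa>"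
          using r powr_powr[of 2 "real j" "- \<kappa>"] by (simp add: powr_mult powr_realpow mult.commute)
        moreover have "(2 ^ (j + 1) * r) ^ DIM('a) = 2 powr (?d * real j) * 2 powr ?d * r powr ?d"
          using r powr_realpow[of "2 ^ (j + 1) * r" "DIM('a)"] powr_powr[of 2 "real (j + 1)" ?d]
            powr_realpow[of 2 "j + 1"]
          by (simp add: powr_mult algebra_simps flip: powr_add)
        moreover have "q ^ j = 2 powr (?d * real j) * 2 powr (- \<kappa> * real j)"
          using powr_realpow[OF q(1), of j] powr_powr[of 2 "?d - \<kappa>" "real j"]
          by (simp add: q_def algebra_simps flip: powr_add)
        moreover have "r powr (?d - \<kappa>) = r powr ?d * r powr - \<kappa>"
          by (simp flip: powr_add)
        ultimately show ?thesis by simp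
      qed
      then have "ennreal ((2 ^ j * r) powr - \<kappa>) * ennreal (V * (2 ^ (j + 1) * r) ^ DIM('a)) =
          ennreal (V * 2 powr ?d * r powr (?d - \<kappa>) * q ^ j)"
        using V r by (subst ennreal_mult[symmetric]) (auto simp: mult_ac)
      moreover have "(\<integral>\<^sup>+z. ?g j z \<partial>lborel) =
          ennreal ((2 ^ j * r) powr - \<kappa>) * ennreal (V * (2 ^ (j + 1) * r) ^ DIM('a))"
        using r by (subst nn_integral_cmult_indicator) (auto simp: emeasure_cball V_def)
      ultimately show "(\<integral>\<^sup>+z. ?g j z \<partial>lborel) = ennreal (V * 2 powr ?d * r powr (?d - \<kappa>) * q ^ j)"
        by simp
    qed
    also have "\<dots> = ennreal (\<Sum>j. V * 2 powr ?d * r powr (?d - \<kappa>) * q ^ j)"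
      using V q by (intro suminf_ennreal2 summable_mult summable_geometric) auto
    also have "(\<Sum>j. V * 2 powr ?d * r powr (?d - \<kappa>) * q ^ j) = V * 2 powr ?d * r powr (?d - \<kappa>) * (1 / (1 - q))"
      using q by (subst suminf_mult) (auto simp: suminf_geometric summable_geometric)
    also have "\<dots> = C * r powr (?d - \<kappa>)" by (simp add: C_def)
    finally show ?thesis .
  qed
  ultimately show ?thesis by blast
qed

lemma emeasure_cube:
  fixes w :: "'a::euclidean_space"
  assumes "0 < r"
  shows "emeasure lborel (cube w r) = ennreal (r ^ DIM('a))"
  using assms unfolding cube_def
  by (subst emeasure_lborel_cbox) (auto simp: inner_simps)

text \<open>Throughout the cube at \<open>w\<close> the distance to the pole is at least a fixed
  fraction of R, its value at \<open>w\<close>. So \<open>K\<close> is bounded there by a multiple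
  of R^(-M), and the weighted volume, of order t^(n+1+a), is at most that power of R because n + 1 +
  a is positive and t is at most R.\<close>

lemma Q_mean_decay:
  fixes K :: "(real ^ 'n) \<times> real \<Rightarrow> real" and M s q a :: real
  assumes M: "0 \<le> M" and s: "0 < s" and q: "0 < q" and a: "- 1 < a"
    and K: "\<And>z. z \<noteq> 0 \<Longrightarrow> \<bar>K z\<bar> \<le> norm z powr - M"
  shows "\<exists>C>0. \<forall>v w. 0 < snd v \<longrightarrow> 0 < snd w \<longrightarrow>
    continuous_on upper_half_space (\<lambda>z. K (z - (fst v, - snd v))) \<longrightarrow>
    Q_mean a s q (\<lambda>z. K (z - (fst v, - snd v))) w \<le>
      ennreal (C * norm (w - (fst v, - snd v)) powr - (M * q - q * (real CARD('n) + 1 + a) / s))"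
proof -
  let ?d = "real CARD('n) + 1"
  \<comment> \<open>For z in the cube, the distance to w is at most ?d t, and t is at most twice the
    height of z, hence at most twice the distance from z to the pole. The triangle inequality adds
    the 1.\<close>
  define D where "D = 2 * ?d + 1"
  have D: "D > 0" by (simp add: D_def)
  define c where "c = 2 powr \<bar>a\<bar> * D powr (M * s)"
  have c: "c > 0" using D by (simp add: c_def)
  define C where "C = c powr (q / s)"
  have "C > 0" using c by (simp add: C_def)
  moreover have "Q_mean a s q (\<lambda>z. K (z - (fst v, - snd v))) w \<le>
      ennreal (C * norm (w - (fst v, - snd v)) powr - (M * q - q * (?d + a) / s))"
    if v: "0 < snd v" and w: "0 < snd w"
      and cont: "continuous_on upper_half_space (\<lambda>z. K (z - (fst v, - snd v)))" for v w
  proof -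
    define v' where "v' = (fst v, - snd v)"
    define t where "t = snd w"
    define R where "R = norm (w - v')"
    have t: "t > 0" using w by (simp add: t_def)
    have height: "snd z \<le> norm (z - v')" if "0 < snd z" for z
      using abs_snd_diff_le_dist[of z v'] v that by (simp add: dist_norm v'_def)
    have tR: "t \<le> R" unfolding t_def R_def by (rule height[OF w])
    have R: "R > 0" using t tR by linarith
    let ?I = "\<integral>\<^sup>+z\<in>Q_cube w. ennreal (\<bar>K (z - v')\<bar> powr s) \<partial>weighted_measure a"
    have pt: "snd z powr a * \<bar>K (z - v')\<bar> powr s \<le> c * t powr a * R powr (- M * s)"
      if z: "z \<in> Q_cube w" "0 < snd z" for z
    proof -
      have "(0, 1) \<in> (Basis :: ((real ^ 'n) \<times> real) set)" by (simp add: Basis_prod_def)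
      then have "\<bar>(z - w) \<bullet> (0, 1)\<bar> \<le> t / 2" using z(1) by (auto simp: mem_cube t_def)
      then have "\<bar>snd z - t\<bar> \<le> t / 2" by (simp add: inner_prod_def t_def)
      then have sz: "snd z \<le> 2 * t" "t \<le> 2 * snd z" using t by linarith+
      then have 1: "snd z powr a \<le> 2 powr \<bar>a\<bar> * t powr a"
        using z t by (intro powr_comparable) auto
      have "dist w z \<le> ?d * t"
        using dist_le_of_mem_cube[OF center_in_cube z(1)] w by (simp add: t_def add.commute)
      also have "\<dots> \<le> ?d * (2 * norm (z - v'))"
        using height[OF z(2)] sz(2) by (intro mult_left_mono) auto
      finally have "R \<le> D * norm (z - v')"
        using dist_triangle[of w v' z] by (simp add: R_def D_def dist_norm algebra_simps)
      then have RD: "R / D \<le> norm (z - v')" using D by (simp add: divide_le_eq mult.commute)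
      have nz: "z - v' \<noteq> 0" using RD R D by (auto simp: divide_le_0_iff)
      have "\<bar>K (z - v')\<bar> \<le> norm (z - v') powr - M" by (rule K[OF nz])
      also have "\<dots> \<le> (R / D) powr - M" using RD R D M by (intro powr_mono2') auto
      finally have "\<bar>K (z - v')\<bar> powr s \<le> ((R / D) powr - M) powr s"
        using s by (intro powr_mono2) auto
      also have "\<dots> = D powr (M * s) * R powr (- M * s)"
        using R D by (simp add: powr_powr powr_divide powr_minus_divide)
      finally have "snd z powr a * \<bar>K (z - v')\<bar> powr s \<le>
          (2 powr \<bar>a\<bar> * t powr a) * (D powr (M * s) * R powr (- M * s))"
        by (intro mult_mono 1) auto
      then show ?thesis by (simp add: c_def mult_ac)
    qed
    have "?I = (\<integral>\<^sup>+z\<in>Q_cube w. ennreal (snd z powr a * \<bar>K (z - v')\<bar> powr s) * indicator upper_half_space z \<partial>lborel)"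
      using cont unfolding v'_def[symmetric] by (intro nn_integral_weighted_measure s) auto
    also have "\<dots> \<le> (\<integral>\<^sup>+z\<in>Q_cube w. ennreal (c * t powr a * R powr (- M * s)) \<partial>lborel)"
      using pt by (intro nn_integral_mono) (auto simp: indicator_def upper_half_space_def intro!: ennreal_leI)
    also have "\<dots> = ennreal (c * t powr a * R powr (- M * s)) * ennreal (t ^ (CARD('n) + 1))"
      using t by (subst nn_integral_cmult_indicator) (auto simp: emeasure_cube t_def add.commute)
    also have "\<dots> = ennreal (c * t powr (?d + a) * R powr (- M * s))"
      using t c by (subst ennreal_mult[symmetric]) (auto simp: powr_add powr_realpow mult_ac)
    also have "\<dots> \<le> ennreal (c * R powr (?d + a) * R powr (- M * s))"
      using a t tR c by (intro ennreal_leI mult_right_mono mult_left_mono powr_mono2) auto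
    also have "\<dots> = ennreal (c * R powr (?d + a - M * s))"
      by (simp add: mult.assoc flip: powr_add)
    finally have "ennreal_powr ?I (q / s) \<le> ennreal_powr (ennreal (c * R powr (?d + a - M * s))) (q / s)"
      using q s by (intro ennreal_powr_mono) auto
    also have "\<dots> = ennreal (C * R powr ((?d + a - M * s) * (q / s)))"
      using c R by (simp add: ennreal_powr_ennreal powr_mult powr_powr C_def)
    also have "(?d + a - M * s) * (q / s) = - (M * q - q * (?d + a) / s)"
      using s by (simp add: field_simps)
    finally show ?thesis by (simp add: Q_mean_def R_def v'_def)
  qed
  ultimately show ?thesis by blast
qed

text \<open>The hypothesis \<open>large\<close> says exactly that the decay exponent exceeds the
  dimension. Every point of the half-space is at distance at least \<open>snd v\<close> from the
  pole, so the tail integral applies with that radius.\<close>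

lemma integral_Q_mean_decay:
  fixes K :: "(real ^ 'n) \<times> real \<Rightarrow> real" and M s q a :: real
  assumes M: "0 \<le> M" and s: "0 < s" and q: "0 < q" and a: "- 1 < a"
    and K: "\<And>z. z \<noteq> 0 \<Longrightarrow> \<bar>K z\<bar> \<le> norm z powr - M"
    and large: "real CARD('n) + 1 + q * (real CARD('n) + 1 + a) / s < M * q"
  shows "\<exists>C>0. \<forall>v. 0 < snd v \<longrightarrow>
    continuous_on upper_half_space (\<lambda>z. K (z - (fst v, - snd v))) \<longrightarrow>
    (\<integral>\<^sup>+w\<in>upper_half_space. Q_mean a s q (\<lambda>z. K (z - (fst v, - snd v))) w \<partial>lborel) \<le>
      ennreal (C * snd v powr (real CARD('n) + 1 + q * (real CARD('n) + 1 + a) / s - M * q))"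
proof -
  let ?d = "real CARD('n) + 1"
  define \<kappa> where "\<kappa> = M * q - q * (?d + a) / s"
  have \<kappa>: "real DIM((real ^ 'n) \<times> real) < \<kappa>" using large by (simp add: \<kappa>_def)
  obtain C1 where C1: "C1 > 0" "\<And>v w. 0 < snd v \<Longrightarrow> 0 < snd w \<Longrightarrow>
    continuous_on upper_half_space (\<lambda>z. K (z - (fst v, - snd v))) \<Longrightarrow>
    Q_mean a s q (\<lambda>z. K (z - (fst v, - snd v))) w \<le>
      ennreal (C1 * norm (w - (fst v, - snd v)) powr - \<kappa>)"
    using Q_mean_decay[OF M s q a K] unfolding \<kappa>_def by blast
  obtain C2 where C2: "C2 > 0" "\<And>(b :: (real ^ 'n) \<times> real) r. 0 < r \<Longrightarrow>
    (\<integral>\<^sup>+z\<in>{z. r \<le> norm (z - b)}. ennreal (norm (z - b) powr - \<kappa>) \<partial>lborel) \<le>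
      ennreal (C2 * r powr (?d - \<kappa>))"
    using nn_integral_norm_powr_le[OF \<kappa>] by (auto simp: add.commute)
  have "C1 * C2 > 0" using C1 C2 by simp
  moreover have "(\<integral>\<^sup>+w\<in>upper_half_space. Q_mean a s q (\<lambda>z. K (z - (fst v, - snd v))) w \<partial>lborel) \<le>
      ennreal (C1 * C2 * snd v powr (?d + q * (?d + a) / s - M * q))"
    if v: "0 < snd v" and cont: "continuous_on upper_half_space (\<lambda>z. K (z - (fst v, - snd v)))" for v
  proof -
    define v' where "v' = (fst v, - snd v)"
    let ?S = "{z. snd v \<le> norm (z - v')}"
    have S: "?S \<in> sets borel"
      by (intro borel_closed closed_Collect_le continuous_intros)
    have [measurable]: "(\<lambda>w. ennreal (norm (w - v') powr - \<kappa>) * indicator ?S w) \<in> borel_measurable borel"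
      using S by (intro borel_measurable_times_ennreal borel_measurable_indicator) measurable
    have "(\<integral>\<^sup>+w\<in>upper_half_space. Q_mean a s q (\<lambda>z. K (z - v')) w \<partial>lborel) \<le>
      (\<integral>\<^sup>+w. ennreal C1 * (ennreal (norm (w - v') powr - \<kappa>) * indicator ?S w) \<partial>lborel)"
    proof (rule nn_integral_mono)
      fix w :: "(real ^ 'n) \<times> real"
      show "Q_mean a s q (\<lambda>z. K (z - v')) w * indicator upper_half_space w \<le>
        ennreal C1 * (ennreal (norm (w - v') powr - \<kappa>) * indicator ?S w)"
      proof (cases "w \<in> upper_half_space")
        case True
        then have w: "0 < snd w" by (simp add: upper_half_space_def)
        have "snd v \<le> norm (w - v')"
          using abs_snd_diff_le_dist[of w v'] v w by (simp add: dist_norm v'_def)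
        then show ?thesis
          using True C1(2)[OF v w cont] C1(1) by (simp add: v'_def flip: ennreal_mult)
      qed simp
    qed
    also have "\<dots> = ennreal C1 * (\<integral>\<^sup>+w\<in>?S. ennreal (norm (w - v') powr - \<kappa>) \<partial>lborel)"
      by (intro nn_integral_cmult) measurable
    also have "\<dots> \<le> ennreal C1 * ennreal (C2 * snd v powr (?d - \<kappa>))"
      by (intro mult_left_mono C2 v) auto
    also have "\<dots> = ennreal (C1 * C2 * snd v powr (?d + q * (?d + a) / s - M * q))"
      using C1 C2 by (simp add: \<kappa>_def algebra_simps flip: ennreal_mult)
    finally show ?thesis by (simp add: v'_def)
  qed
  ultimately show ?thesis by blast
qed

lemma emeasure_ball_le_of_carleson_inequality:
  fixes \<mu> :: "((real ^ 'n) \<times> real) measure" and p \<sigma> \<alpha> :: "'i \<Rightarrow> real"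
  assumes I: "finite I"
    and p: "\<And>i. i \<in> I \<Longrightarrow> 0 < p i" and \<sigma>: "\<And>i. i \<in> I \<Longrightarrow> 0 < \<sigma> i"
    and \<alpha>: "\<And>i. i \<in> I \<Longrightarrow> - 1 < \<alpha> i"
    and \<mu>: "sets \<mu> = sets (restrict_space borel upper_half_space)"
    and C: "0 < C"
    and ineq: "\<And>f. (\<forall>i\<in>I. harmonic_on (f i) upper_half_space) \<Longrightarrow>
      (\<integral>\<^sup>+z. ennreal (\<Prod>i\<in>I. \<bar>f i z\<bar> powr p i) \<partial>\<mu>) \<le>
        ennreal C * (\<Prod>i\<in>I. \<integral>\<^sup>+w\<in>upper_half_space. Q_mean (\<alpha> i) (\<sigma> i) (p i) (f i) w \<partial>lborel)"
  shows "\<exists>\<epsilon>>0. \<epsilon> < 1 \<and> (\<exists>C>0. \<forall>w. 0 < snd w \<longrightarrow> emeasure \<mu> (ball w (\<epsilon> * snd w)) \<le>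
    ennreal (C * snd w powr (\<Sum>i\<in>I. real CARD('n) + 1 + p i * (real CARD('n) + 1 + \<alpha> i) / \<sigma> i)))"
proof -
  define e where "e i = real CARD('n) + 1 + p i * (real CARD('n) + 1 + \<alpha> i) / \<sigma> i" for i
  define E where "E = (\<Sum>i\<in>I. e i)"
  \<comment> \<open>The sum dominates each single ratio, so one degree N makes the decay sufficient
    for every index.\<close>
  obtain N :: nat where N: "(\<Sum>i\<in>I. \<bar>e i\<bar> / p i) < real N"
    using reals_Archimedean2 by blast
  define M where "M = real CARD('n) - 1 + real N"
  have MN: "real N \<le> M" by (simp add: M_def Suc_le_eq)
  then have M: "0 \<le> M" by linarith
  have large: "e i < M * p i" if i: "i \<in> I" for i
  proof -
    have "\<bar>e i\<bar> / p i \<le> (\<Sum>i\<in>I. \<bar>e i\<bar> / p i)"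
      using I i p by (intro member_le_sum) (auto simp: less_imp_le)
    then have "\<bar>e i\<bar> / p i < M" using N MN by linarith
    then have "\<bar>e i\<bar> < M * p i" using p[OF i] by (simp add: divide_less_eq)
    then show ?thesis by linarith
  qed
  obtain K :: "(real ^ 'n) \<times> real \<Rightarrow> real" and c \<epsilon> where c: "c > 0" and \<epsilon>: "\<epsilon> > 0" "\<epsilon> < 1"
    and harm: "\<forall>w. 0 < snd w \<longrightarrow> harmonic_on (\<lambda>z. K (z - (fst w, - snd w))) upper_half_space"
    and up: "\<forall>z. z \<noteq> 0 \<longrightarrow> \<bar>K z\<bar> \<le> norm z powr - M"
    and low: "\<forall>w z. 0 < snd w \<longrightarrow> z \<in> ball w (\<epsilon> * snd w) \<longrightarrow>
       c * snd w powr - M \<le> K (z - (fst w, - snd w))"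
    using ex_decaying_harmonic[of N, where 'n='n] unfolding M_def[symmetric] by (elim exE conjE) (rule that)
  have "\<forall>i\<in>I. \<exists>C>0. \<forall>v. 0 < snd v \<longrightarrow>
    continuous_on upper_half_space (\<lambda>z. K (z - (fst v, - snd v))) \<longrightarrow>
    (\<integral>\<^sup>+w\<in>upper_half_space. Q_mean (\<alpha> i) (\<sigma> i) (p i) (\<lambda>z. K (z - (fst v, - snd v))) w \<partial>lborel) \<le>
      ennreal (C * snd v powr (e i - M * p i))"
    unfolding e_def using M p \<sigma> \<alpha> up large[unfolded e_def]
    by (intro ballI integral_Q_mean_decay) auto
  from bchoice[OF this] obtain b where b: "\<forall>i\<in>I. b i > 0 \<and> (\<forall>v. 0 < snd v \<longrightarrow>
    continuous_on upper_half_space (\<lambda>z. K (z - (fst v, - snd v))) \<longrightarrow>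
    (\<integral>\<^sup>+w\<in>upper_half_space. Q_mean (\<alpha> i) (\<sigma> i) (p i) (\<lambda>z. K (z - (fst v, - snd v))) w \<partial>lborel) \<le>
      ennreal (b i * snd v powr (e i - M * p i)))" ..
  define L where "L = (\<Prod>i\<in>I. c powr p i)"
  have L: "L > 0" using c by (simp add: L_def prod_pos)
  define B where "B = (\<Prod>i\<in>I. b i)"
  have B: "B > 0" using b by (simp add: B_def prod_pos)
  have "C * B / L > 0" using C B L by simp
  moreover have "emeasure \<mu> (ball w (\<epsilon> * snd w)) \<le> ennreal (C * B / L * snd w powr E)"
    if w: "0 < snd w" for w
  proof -
    define t where "t = snd w"
    have t: "t > 0" using w by (simp add: t_def)
    define P where "P = (\<Sum>i\<in>I. M * p i)"
    let ?f = "\<lambda>z. K (z - (fst w, - snd w))"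
    let ?U = "ball w (\<epsilon> * snd w)"
    have f: "harmonic_on ?f upper_half_space" using harm w by blast
    then have fc: "continuous_on upper_half_space ?f" by (rule harmonic_on_imp_continuous_on)
    have "\<epsilon> * snd w < 1 * snd w" using \<epsilon> w by (intro mult_strict_right_mono) auto
    then have "?U \<subseteq> upper_half_space"
      using cball_subset_upper_half_space[of "\<epsilon> * snd w" w] ball_subset_cball by force
    then have U: "?U \<in> sets \<mu>" by (auto simp: \<mu> sets_restrict_space_iff)
    have "ennreal (L * t powr - P) * emeasure \<mu> ?U = (\<integral>\<^sup>+z. ennreal (L * t powr - P) * indicator ?U z \<partial>\<mu>)"
      using U by (simp add: nn_integral_cmult_indicator)
    also have "\<dots> \<le> (\<integral>\<^sup>+z. ennreal (\<Prod>i\<in>I. \<bar>?f z\<bar> powr p i) \<partial>\<mu>)"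
    proof (rule nn_integral_mono)
      fix z
      have "L * t powr - P \<le> (\<Prod>i\<in>I. \<bar>?f z\<bar> powr p i)" if z: "z \<in> ?U"
      proof -
        have "L * t powr - P = (\<Prod>i\<in>I. c powr p i * t powr (- M * p i))"
          using t I by (simp add: L_def P_def prod.distrib powr_sum sum_negf[symmetric] del: sum_negf)
        also have "\<dots> = (\<Prod>i\<in>I. (c * t powr - M) powr p i)"
          using c by (simp add: powr_mult powr_powr)
        also have "\<dots> \<le> (\<Prod>i\<in>I. \<bar>?f z\<bar> powr p i)"
        proof (intro prod_mono conjI powr_mono2)
          have "c * t powr - M \<le> ?f z" using low[rule_format, OF w z] by (simp add: t_def)
          then show "c * t powr - M \<le> \<bar>?f z\<bar>" by linarith
        qed (use p c in \<open>auto simp: less_imp_le\<close>)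
        finally show ?thesis .
      qed
      then show "ennreal (L * t powr - P) * indicator ?U z \<le> ennreal (\<Prod>i\<in>I. \<bar>?f z\<bar> powr p i)"
        by (auto simp: indicator_def intro!: ennreal_leI)
    qed
    also have "\<dots> \<le> ennreal C *
        (\<Prod>i\<in>I. \<integral>\<^sup>+w\<in>upper_half_space. Q_mean (\<alpha> i) (\<sigma> i) (p i) ?f w \<partial>lborel)"
      using f by (intro ineq) auto
    also have "\<dots> \<le> ennreal C * (\<Prod>i\<in>I. ennreal (b i * t powr (e i - M * p i)))"
    proof (intro mult_left_mono prod_mono_ennreal)
      fix i assume "i \<in> I"
      from b[THEN bspec, OF this] w fc
      show "(\<integral>\<^sup>+w\<in>upper_half_space. Q_mean (\<alpha> i) (\<sigma> i) (p i) ?f w \<partial>lborel) \<le>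
          ennreal (b i * t powr (e i - M * p i))"
        unfolding t_def by blast
    qed auto
    also have "(\<Prod>i\<in>I. ennreal (b i * t powr (e i - M * p i))) = ennreal (B * t powr (E - P))"
    proof -
      have "(\<Prod>i\<in>I. t powr (e i - M * p i)) = t powr (E - P)"
        using t I by (simp add: E_def P_def powr_sum sum_subtractf flip: powr_sum)
      then show ?thesis
        using b by (subst prod_ennreal) (auto simp: B_def prod.distrib less_imp_le)
    qed
    finally have le: "ennreal (L * t powr - P) * emeasure \<mu> ?U \<le> ennreal C * ennreal (B * t powr (E - P))" .
    \<comment> \<open>Undoing the factor restores t^P, and P + (E - P) = E: the auxiliary exponent M
      disappears from the result.\<close>
    have "emeasure \<mu> ?U = ennreal (t powr P / L) * (ennreal (L * t powr - P) * emeasure \<mu> ?U)"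
      using L t by (simp add: powr_minus mult.assoc[symmetric] flip: ennreal_mult)
    also have "\<dots> \<le> ennreal (t powr P / L) * (ennreal C * ennreal (B * t powr (E - P)))"
      by (intro mult_left_mono le) auto
    also have "\<dots> = ennreal (t powr P / L * (C * (B * t powr (E - P))))"
      using L C B by (simp flip: ennreal_mult)
    also have "t powr P / L * (C * (B * t powr (E - P))) = C * B / L * t powr E"
      using t by (simp add: powr_diff)
    finally show ?thesis by (simp add: t_def)
  qed
  ultimately show ?thesis using \<epsilon> unfolding E_def e_def by blast
qed

text \<open>
  Rescaled to height \<open>1\<close>, the Whitney cubes lie in a fixed compact set, so a bounded number of
  small balls covers each of them.
\<close>

lemma emeasure_whitney_le_of_ball_le:
  fixes \<mu> :: "((real ^ 'n) \<times> real) measure" and E \<epsilon> C :: real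
  assumes \<mu>: "sets \<mu> = sets (restrict_space borel upper_half_space)"
    and W: "whitney_decomposition upper_half_space \<zeta> l"
    and \<epsilon>: "0 < \<epsilon>" "\<epsilon> < 1" and C: "0 < C"
    and ball_le: "\<And>w. 0 < snd w \<Longrightarrow> emeasure \<mu> (ball w (\<epsilon> * snd w)) \<le> ennreal (C * snd w powr E)"
  shows "\<exists>C>0. \<forall>k. emeasure \<mu> (cube (\<zeta> k) (l k)) \<le> ennreal (C * snd (\<zeta> k) powr E)"
proof -
  let ?d = "real (CARD('n) + 1)"
  from W have l: "\<And>k. l k > 0" and un: "(\<Union>k. cube (\<zeta> k) (l k)) = upper_half_space"
    unfolding whitney_decomposition_def by auto
  have \<zeta>: "\<zeta> k \<in> cube (\<zeta> k) (l k)" for k using l[of k] by (intro center_in_cube) simp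
  then have \<eta>: "snd (\<zeta> k) > 0" for k using un by (auto simp: upper_half_space_def)
  obtain A where A: "A \<ge> 1" "\<And>k z. z \<in> cube (\<zeta> k) (l k) \<Longrightarrow> l k \<le> A * snd z"
    "\<And>k z. z \<in> cube (\<zeta> k) (l k) \<Longrightarrow> snd z \<le> A * l k"
    using whitney_decomposition_comparable[OF W] by blast
  \<comment> \<open>Contains each cube after its center's foot on the boundary is moved to 0 and
    lengths are divided by the height of the center: ?d * A bounds the distance to the center, 1 is
    the step from center to foot, and heights compare up to the square of A.\<close>
  define Z :: "((real ^ 'n) \<times> real) set" where "Z = cball 0 (?d * A + 1) \<inter> {v. 1 / A\<^sup>2 \<le> snd v}"
  have "compact Z"
    unfolding Z_def by (intro compact_Int_closed compact_cball closed_Collect_le continuous_intros)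
  moreover have Z_pos: "snd v > 0" if "v \<in> Z" for v
  proof -
    have "0 < 1 / A\<^sup>2" using A(1) by simp
    also have "\<dots> \<le> snd v" using that by (simp add: Z_def)
    finally show ?thesis .
  qed
  moreover have "Z \<subseteq> (\<Union>v\<in>Z. ball v (\<epsilon> * snd v))"
    using Z_pos \<epsilon>(1) by force
  ultimately obtain V where V: "V \<subseteq> Z" "finite V" "Z \<subseteq> (\<Union>v\<in>V. ball v (\<epsilon> * snd v))"
    by (elim compactE_image[where C=Z and f="\<lambda>v. ball v (\<epsilon> * snd v)"]) auto
  \<comment> \<open>The added 1 makes the constant positive without a look at
    \<open>V\<close>.\<close>
  define C' where "C' = C * (\<Sum>v\<in>V. snd v powr E) + 1"
  have "C' > 0" using C by (simp add: C'_def add_nonneg_pos sum_nonneg)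
  moreover have "emeasure \<mu> (cube (\<zeta> k) (l k)) \<le> ennreal (C' * snd (\<zeta> k) powr E)" for k
  proof -
    define t where "t = snd (\<zeta> k)"
    have t: "t > 0" using \<eta> by (simp add: t_def)
    \<comment> \<open>Undoes the normalization. It multiplies heights and distances alike by t, so
      it carries the covering balls to balls of the form in \<open>ball_le\<close>.\<close>
    define T where "T v = (fst (\<zeta> k), 0) + t *\<^sub>R v" for v :: "(real ^ 'n) \<times> real"
    let ?U = "\<lambda>v. ball (T v) (\<epsilon> * snd (T v))"
    have sT: "snd (T v) = t * snd v" for v by (simp add: T_def)
    have V_pos: "0 < snd v" "0 < snd (T v)" if "v \<in> V" for v
      using Z_pos[OF subsetD[OF V(1) that]] t by (simp_all add: sT)
    have U: "?U v \<in> sets \<mu>" if "v \<in> V" for v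
    proof -
      have "\<epsilon> * snd (T v) < 1 * snd (T v)" using \<epsilon> V_pos(2)[OF that] by (intro mult_strict_right_mono) auto
      then have "?U v \<subseteq> upper_half_space"
        using cball_subset_upper_half_space[of "\<epsilon> * snd (T v)" "T v"] ball_subset_cball by force
      then show ?thesis by (auto simp: \<mu> sets_restrict_space_iff)
    qed
    have cover: "cube (\<zeta> k) (l k) \<subseteq> (\<Union>v\<in>V. ?U v)"
    proof
      fix z assume z: "z \<in> cube (\<zeta> k) (l k)"
      define v where "v = (1 / t) *\<^sub>R (z - (fst (\<zeta> k), 0))"
      have Tv: "z = T v" using t by (simp add: T_def v_def)
      have "norm (z - (fst (\<zeta> k), 0)) \<le> dist z (\<zeta> k) + dist (\<zeta> k) (fst (\<zeta> k), 0)"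
        using dist_triangle[of z "(fst (\<zeta> k), 0)" "\<zeta> k"] by (simp add: dist_norm)
      also have "dist (\<zeta> k) (fst (\<zeta> k), 0) = t"
        using t by (simp add: dist_prod_def dist_real_def t_def)
      also have "dist z (\<zeta> k) \<le> ?d * l k"
        using dist_le_of_mem_cube[OF z \<zeta>] by (simp add: add.commute)
      also have "\<dots> \<le> ?d * (A * t)"
        using A(2)[OF \<zeta>[of k]] by (intro mult_left_mono) (auto simp: t_def)
      finally have "norm (z - (fst (\<zeta> k), 0)) \<le> (?d * A + 1) * t" by (simp add: algebra_simps)
      then have "norm v \<le> ?d * A + 1"
        using t by (simp add: v_def divide_le_eq)
      moreover have "1 / A\<^sup>2 \<le> snd v"
      proof -
        have "t \<le> A * (A * snd z)"
          using order_trans[OF A(3)[OF \<zeta>[of k]] mult_left_mono[OF A(2)[OF z], of A]] A(1)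
          by (simp add: t_def)
        then show ?thesis
          using t A(1) by (simp add: v_def field_simps power2_eq_square)
      qed
      ultimately have "v \<in> Z" by (simp add: Z_def)
      then obtain u where u: "u \<in> V" "v \<in> ball u (\<epsilon> * snd u)" using V(3) by blast
      have "dist (T u) (T v) = t * dist u v"
        using t by (simp add: T_def dist_norm flip: scaleR_diff_right)
      then have "z \<in> ?U u"
        using u(2) t by (simp add: Tv sT mult.left_commute)
      then show "z \<in> (\<Union>v\<in>V. ?U v)" using u(1) by blast
    qed
    have "emeasure \<mu> (cube (\<zeta> k) (l k)) \<le> emeasure \<mu> (\<Union>v\<in>V. ?U v)"
      using cover U V(2) by (intro emeasure_mono sets.finite_UN) auto
    also have "\<dots> \<le> (\<Sum>v\<in>V. emeasure \<mu> (?U v))"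
      using V(2) U by (intro emeasure_subadditive_finite) auto
    also have "\<dots> \<le> (\<Sum>v\<in>V. ennreal (C * (t * snd v) powr E))"
      using V_pos by (intro sum_mono order_trans[OF ball_le]) (auto simp: sT)
    also have "\<dots> = ennreal (\<Sum>v\<in>V. C * (t * snd v) powr E)"
      using C by (intro sum_ennreal) auto
    also have "(\<Sum>v\<in>V. C * (t * snd v) powr E) = C * (\<Sum>v\<in>V. snd v powr E) * t powr E"
      using V_pos(1) t by (simp add: sum_distrib_left sum_distrib_right powr_mult less_imp_le mult_ac)
    also have "\<dots> \<le> C' * t powr E" by (intro mult_right_mono) (auto simp: C'_def)
    finally show ?thesis by (simp add: t_def ennreal_leI)
  qed
  ultimately show ?thesis by blast
qed

theorem theorem5:
  fixes m :: nat
    and p \<sigma> \<alpha> :: "nat \<Rightarrow> real"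
    and \<mu> :: "((real ^ 'n) \<times> real) measure"
    and \<zeta> :: "nat \<Rightarrow> (real ^ 'n) \<times> real"
    and l :: "nat \<Rightarrow> real"
  assumes "m \<ge> 1"
    and "\<And>i. i \<in> {1..m} \<Longrightarrow> 0 < p i"
    and "\<And>i. i \<in> {1..m} \<Longrightarrow> 0 < \<sigma> i"
    and "\<And>i. i \<in> {1..m} \<Longrightarrow> -1 < \<alpha> i"
    and "sets \<mu> = sets (restrict_space borel upper_half_space)"
    and "whitney_decomposition upper_half_space \<zeta> l"
  shows
    "(\<exists>C>0. \<forall>f :: nat \<Rightarrow> (real ^ 'n) \<times> real \<Rightarrow> real.
        (\<forall>i\<in>{1..m}. harmonic_on (f i) upper_half_space) \<longrightarrow>
        (\<integral>\<^sup>+z. ennreal (\<Prod>i=1..m. \<bar>f i z\<bar> powr p i) \<partial>\<mu>)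
          \<le> ennreal C *
             (\<Prod>i=1..m. \<integral>\<^sup>+w\<in>upper_half_space.
                ennreal_powr
                  (\<integral>\<^sup>+z\<in>Q_cube w. ennreal (\<bar>f i z\<bar> powr \<sigma> i) \<partial>weighted_measure (\<alpha> i))
                  (p i / \<sigma> i) \<partial>lborel))
     \<longleftrightarrow>
     (\<exists>C>0. \<forall>k.
        emeasure \<mu> (cube (\<zeta> k) (l k))
          \<le> ennreal (C * snd (\<zeta> k) powr
              (real m * (real CARD('n) + 1) +
               (\<Sum>i=1..m. p i * (real CARD('n) + 1 + \<alpha> i) / \<sigma> i))))"
proof -
  have E: "(\<Sum>i=1..m. real CARD('n) + 1 + p i * (real CARD('n) + 1 + \<alpha> i) / \<sigma> i) =
    real m * (real CARD('n) + 1) + (\<Sum>i=1..m. p i * (real CARD('n) + 1 + \<alpha> i) / \<sigma> i)"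
    by (simp add: sum.distrib distrib_left)
  show ?thesis
    unfolding E[symmetric] Q_mean_def[symmetric]
  proof
    assume "\<exists>C>0. \<forall>f :: nat \<Rightarrow> (real ^ 'n) \<times> real \<Rightarrow> real.
        (\<forall>i\<in>{1..m}. harmonic_on (f i) upper_half_space) \<longrightarrow>
        (\<integral>\<^sup>+z. ennreal (\<Prod>i=1..m. \<bar>f i z\<bar> powr p i) \<partial>\<mu>)
          \<le> ennreal C *
             (\<Prod>i=1..m. \<integral>\<^sup>+w\<in>upper_half_space. Q_mean (\<alpha> i) (\<sigma> i) (p i) (f i) w \<partial>lborel)"
    then obtain C where C: "C > 0" "\<forall>f :: nat \<Rightarrow> (real ^ 'n) \<times> real \<Rightarrow> real.
        (\<forall>i\<in>{1..m}. harmonic_on (f i) upper_half_space) \<longrightarrow>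
        (\<integral>\<^sup>+z. ennreal (\<Prod>i=1..m. \<bar>f i z\<bar> powr p i) \<partial>\<mu>)
          \<le> ennreal C *
             (\<Prod>i=1..m. \<integral>\<^sup>+w\<in>upper_half_space. Q_mean (\<alpha> i) (\<sigma> i) (p i) (f i) w \<partial>lborel)"
      by (elim exE conjE) (rule that)
    have "\<exists>\<epsilon>>0. \<epsilon> < 1 \<and> (\<exists>C>0. \<forall>w. 0 < snd w \<longrightarrow> emeasure \<mu> (ball w (\<epsilon> * snd w)) \<le>
      ennreal (C * snd w powr (\<Sum>i=1..m. real CARD('n) + 1 + p i * (real CARD('n) + 1 + \<alpha> i) / \<sigma> i)))"
      by (rule emeasure_ball_le_of_carleson_inequality[OF _ assms(2-5) C(1) C(2)[rule_format]]) simp_all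
    then obtain \<epsilon> C' where ball: "\<epsilon> > 0" "\<epsilon> < 1" "C' > 0"
      "\<forall>w. 0 < snd w \<longrightarrow> emeasure \<mu> (ball w (\<epsilon> * snd w)) \<le> ennreal (C' * snd w powr
        (\<Sum>i=1..m. real CARD('n) + 1 + p i * (real CARD('n) + 1 + \<alpha> i) / \<sigma> i))"
      by (elim exE conjE) (rule that)
    show "\<exists>C>0. \<forall>k. emeasure \<mu> (cube (\<zeta> k) (l k)) \<le> ennreal (C * snd (\<zeta> k) powr
        (\<Sum>i=1..m. real CARD('n) + 1 + p i * (real CARD('n) + 1 + \<alpha> i) / \<sigma> i))"
      using emeasure_whitney_le_of_ball_le[OF assms(5,6) ball(1-3) ball(4)[rule_format]] by simp
  next
    assume "\<exists>C>0. \<forall>k. emeasure \<mu> (cube (\<zeta> k) (l k)) \<le> ennreal (C * snd (\<zeta> k) powr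
        (\<Sum>i=1..m. real CARD('n) + 1 + p i * (real CARD('n) + 1 + \<alpha> i) / \<sigma> i))"
    then obtain C where "C > 0" "\<forall>k. emeasure \<mu> (cube (\<zeta> k) (l k)) \<le> ennreal (C * snd (\<zeta> k) powr
        (\<Sum>i=1..m. real CARD('n) + 1 + p i * (real CARD('n) + 1 + \<alpha> i) / \<sigma> i))"
      by (elim exE conjE) (rule that)
    with assms show "\<exists>C>0. \<forall>f :: nat \<Rightarrow> (real ^ 'n) \<times> real \<Rightarrow> real.
        (\<forall>i\<in>{1..m}. harmonic_on (f i) upper_half_space) \<longrightarrow>
        (\<integral>\<^sup>+z. ennreal (\<Prod>i=1..m. \<bar>f i z\<bar> powr p i) \<partial>\<mu>)
          \<le> ennreal C *
             (\<Prod>i=1..m. \<integral>\<^sup>+w\<in>upper_half_space. Q_mean (\<alpha> i) (\<sigma> i) (p i) (f i) w \<partial>lborel)"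
      by (intro carleson_inequality_of_whitney) auto
  qed
qed

end
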